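(* Let $\gamma:S^n\to\mathbb R_{>0}$ be of class $C^2$, and let $X:M=\cup_{i=1}^kM_i\to\mathbb R^{n+1}$ be a piecewise-$C^2$ weak immersion. Consider anisotropic parallel hypersurfaces $X_t=X+t\tilde\xi:M\setminus S(X)\to\mathbb R^{n+1}$, where $S(X)$ is the set of singular points of $X$. Then $$\mathcal F_\gamma(X_t)=\int_M\gamma(\nu)\,dA_t=\int_M\gamma(\nu)(1-tk_1^\gamma)\cdots(1-tk_n^\gamma)\,dA,$$ where $\int_M$ means $\sum_{i=1}^k\int_{M_i}$. Moreover, if the $r$-th anisotropic mean curvature $H^\gamma_r$ of $X$ for $\gamma$ is integrable on $M$ for $r=1,\dots,n$, then $$\mathcal F_\gamma(X_t)=\sum_{r=0}^n(-1)^rt^r\binom nr\int_M\gamma(\nu)H_r^\gamma\,dA.$$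
   Context: **Piecewise-$C^r$ weak immersion.** $M=\cup_{i=1}^kM_i$ is an $n$-dimensional oriented compact connected $C^\infty$ manifold, where each $M_i$ is an $n$-dimensional connected compact submanifold of $M$ with piecewise-$C^\infty$ boundary and $M_i\cap M_j=\partial M_i\cap\partial M_j$ for $i\neq j$. A map $X:M\to\mathbb R^{n+1}$ is a piecewise-$C^r$ weak immersion if for each $i$: (A1) $X$ is continuous and $X|_{M_i}$ is of class $C^r$; (A2) $X$ restricted to the interior $M_i^o$ is a $C^r$-immersion; (A3) the unit normal field $\nu_i:M_i^o\to S^n$ extends to a $C^{r-1}$ map $\nu_i:M_i\to S^n$; here $\nu_i$ is chosen so that, in positively oriented local coordinates $(u^1,\dots,u^n)$, $(\nu_i,\partial_{u^1}X,\dots,\partial_{u^n}X)$ is compatible with the canonical orientation of $\mathbb R^{n+1}$. A singular point of $X$ is a point of $M$ at which $X$ is not an immersion; $\nu$ is the unit normal on $M\setminus S(X)$, $dA$ and $dA_t$ are the $n$-dimensional volume forms induced by $X$ and $X_t$. $\mathcal F_\gamma(X)=\int_M\gamma(\nu)\,dA$. **Cahn-Hoffman field, parallel hypersurfaces.** $\xi(\nu)=D\gamma|_\nu+\gamma(\nu)\nu$ for $\nu$ in the unit sphere $S^n$ ($D\gamma$ the gradient on $S^n$, $T_\nu S^n\subset\mathbb R^{n+1}$), and $\tilde\xi=\xi\circ\nu$ along $X$. For real $t$, $X_t=X+t\tilde\xi$ is the anisotropic parallel deformation of $X$ of height $t$; it is called the anisotropic parallel hypersurface of height $t$ when it is a piecewise-$C^2$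 weak immersion. The unit normal along $X_t$ is $\nu$. **Anisotropic curvatures.** At regular points of $X$, $k_1^\gamma,\dots,k_n^\gamma$ are the eigenvalues of $S^\gamma=-d\tilde\xi$, regarded as an endomorphism of the tangent space (the image of $d\tilde\xi$ is perpendicular to $\nu$). $H_r^\gamma=\binom nr^{-1}\sum_{l_1<\dots<l_r}k^\gamma_{l_1}\cdots k^\gamma_{l_r}$ and $H_0^\gamma=1$. Integrability is with respect to $dA$. *)

theory Defs
  imports "HOL-Analysis.Analysis" "HOL-Computational_Algebra.Computational_Algebra"
begin

section \<open>Functions of class \<open>C\<^sup>k\<close>\<close>

primrec Ck_open :: "nat \<Rightarrow> 'a::real_normed_vector set \<Rightarrow> ('a \<Rightarrow> 'b::real_normed_vector) \<Rightarrow> bool" where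
  "Ck_open 0 S f \<longleftrightarrow> continuous_on S f"
| "Ck_open (Suc k) S f \<longleftrightarrow> (\<forall>x\<in>S. f differentiable (at x)) \<and>
     (\<forall>v. Ck_open k S (\<lambda>x. frechet_derivative f (at x) v))"

text \<open>On a set that need not be open, \<open>C\<^sup>k\<close> means: locally the restriction of a \<open>C\<^sup>k\<close> function
  defined on an open set.  For the unit sphere this is the class \<open>C\<^sup>k\<close> of the submanifold.\<close>

definition Ck_on :: "nat \<Rightarrow> 'a::real_normed_vector set \<Rightarrow> ('a \<Rightarrow> 'b::real_normed_vector) \<Rightarrow> bool" where
  "Ck_on k S f \<longleftrightarrow>
     (\<forall>x\<in>S. \<exists>W g. open W \<and> x \<in> W \<and> Ck_open k W g \<and> (\<forall>y\<in>S \<inter> W. g y = f y))"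

section \<open>Oriented smooth manifolds\<close>

text \<open>The manifold \<open>M\<close> is the whole type \<open>'m\<close>; it has no boundary and its dimension is \<open>CARD('n)\<close>.
  A chart is a pair of a coordinate domain and a coordinate map, whose values outside the
  domain are irrelevant.\<close>

type_synonym ('m, 'n) chart = "'m set \<times> ('m \<Rightarrow> real ^ 'n)"

definition chart_inv :: "('m, 'n) chart \<Rightarrow> real ^ 'n \<Rightarrow> 'm" where
  "chart_inv c = inv_into (fst c) (snd c)"

definition is_chart :: "('m::topological_space, 'n::finite) chart \<Rightarrow> bool" where
  "is_chart c \<longleftrightarrow> open (fst c) \<and> open (snd c ` fst c) \<and>
     homeomorphism (fst c) (snd c ` fst c) (snd c) (chart_inv c)"

definition smooth_transition ::
  "('m::topological_space, 'n::finite) chart \<Rightarrow> ('m, 'n) chart \<Rightarrow> bool" where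
  "smooth_transition c d \<longleftrightarrow>
     (\<forall>r. Ck_open r (snd c ` (fst c \<inter> fst d)) (snd d \<circ> chart_inv c))"

definition oriented_smooth_atlas :: "('m::topological_space, 'n::finite) chart set \<Rightarrow> bool" where
  "oriented_smooth_atlas A \<longleftrightarrow>
     (\<forall>c\<in>A. is_chart c) \<and> (\<Union>c\<in>A. fst c) = UNIV \<and>
     (\<forall>c\<in>A. \<forall>d\<in>A. smooth_transition c d \<and>
        (\<forall>x\<in>snd c ` (fst c \<inter> fst d).
           det (matrix (frechet_derivative (snd d \<circ> chart_inv c) (at x))) > 0))"

text \<open>Charts of the smooth structure generated by \<open>A\<close>, of either orientation.\<close>

definition smooth_chart :: "('m::topological_space, 'n::finite) chart set \<Rightarrow> ('m, 'n) chart \<Rightarrow> bool" where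
  "smooth_chart A c \<longleftrightarrow>
     is_chart c \<and> (\<forall>d\<in>A. smooth_transition c d \<and> smooth_transition d c)"

definition Cr_on :: "('m::topological_space, 'n::finite) chart set \<Rightarrow> nat \<Rightarrow> 'm set \<Rightarrow>
    ('m \<Rightarrow> 'b::real_normed_vector) \<Rightarrow> bool" where
  "Cr_on A r S f \<longleftrightarrow> (\<forall>c\<in>A. Ck_on r (snd c ` (fst c \<inter> S)) (f \<circ> chart_inv c))"

text \<open>The differential of \<open>f\<close> at \<open>p\<close> and its partial derivatives, in the coordinates of \<open>c\<close>.\<close>

definition chart_deriv :: "('m, 'n::finite) chart \<Rightarrow> ('m \<Rightarrow> 'b::real_normed_vector) \<Rightarrow>
    'm \<Rightarrow> real ^ 'n \<Rightarrow> 'b" where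
  "chart_deriv c f p = frechet_derivative (f \<circ> chart_inv c) (at (snd c p))"

definition chart_partial :: "('m, 'n::finite) chart \<Rightarrow> 'n \<Rightarrow> ('m \<Rightarrow> 'b::real_normed_vector) \<Rightarrow>
    'm \<Rightarrow> 'b" where
  "chart_partial c j f p = chart_deriv c f p (axis j 1)"

section \<open>Decomposition into pieces with piecewise smooth boundary\<close>

text \<open>A compact piece of a smooth hypersurface: it lies in a coordinate hyperplane of some chart of
  the smooth structure and is regular closed there, that is, genuinely \<open>(n-1)\<close>-dimensional.\<close>

definition hypersurface_piece :: "('m::topological_space, 'n::finite) chart set \<Rightarrow> 'm set \<Rightarrow> bool" where
  "hypersurface_piece A Q \<longleftrightarrow> compact Q \<and>
     (\<exists>c j. smooth_chart A c \<and> Q \<subseteq> fst c \<and> snd c ` Q \<subseteq> {x. x $ j = 0} \<and>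
        snd c ` Q \<subseteq> closure ((top_of_set {x. x $ j = 0}) interior_of (snd c ` Q)))"

text \<open>Compact connected \<open>n\<close>-dimensional submanifolds with piecewise smooth boundary.  Since the
  dimension is that of \<open>M\<close> and \<open>M\<close> has no boundary, the manifold boundary and the manifold interior
  of \<open>R\<close> are \<open>frontier R\<close> and \<open>interior R\<close>.\<close>

definition piecewise_smooth_region :: "('m::topological_space, 'n::finite) chart set \<Rightarrow> 'm set \<Rightarrow> bool" where
  "piecewise_smooth_region A R \<longleftrightarrow> compact R \<and> connected R \<and> R \<noteq> {} \<and>
     (\<forall>p\<in>R. \<exists>U (W :: (real ^ 'n) set) j. openin (top_of_set R) U \<and> p \<in> U \<and>
        openin (top_of_set {x. 0 \<le> x $ j}) W \<and> U homeomorphic W) \<and>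
     (\<exists>\<Q>. finite \<Q> \<and> (\<forall>Q\<in>\<Q>. hypersurface_piece A Q) \<and> \<Union>\<Q> = frontier R)"

definition piecewise_decomposition ::
  "('m::topological_space, 'n::finite) chart set \<Rightarrow> nat \<Rightarrow> (nat \<Rightarrow> 'm set) \<Rightarrow> bool" where
  "piecewise_decomposition A k P \<longleftrightarrow>
     (\<forall>i\<in>{1..k}. piecewise_smooth_region A (P i)) \<and> (\<Union>i\<in>{1..k}. P i) = UNIV \<and>
     (\<forall>i\<in>{1..k}. \<forall>j\<in>{1..k}. i \<noteq> j \<longrightarrow> P i \<inter> P j = frontier (P i) \<inter> frontier (P j))"

section \<open>Piecewise weak immersions\<close>

text \<open>The ambient space of dimension \<open>n + 1\<close> is \<open>real ^ 'n option\<close>, with \<open>None\<close> as the index of the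
  first coordinate.  The rows of the following determinant are \<open>v, w\<^sub>1, \<dots>, w\<^sub>n\<close>; rows and columns are
  indexed by the same type, so its value does not depend on an enumeration of \<open>'n\<close> and it is
  positive exactly for the bases compatible with the canonical orientation.\<close>

definition frame_det :: "real ^ ('n::finite option) \<Rightarrow> ('n \<Rightarrow> real ^ 'n option) \<Rightarrow> real" where
  "frame_det v w = det (\<chi> a. case a of None \<Rightarrow> v | Some j \<Rightarrow> w j)"

definition immersion_at :: "('m::topological_space, 'n::finite) chart set \<Rightarrow> nat \<Rightarrow>
    ('m \<Rightarrow> 'b::real_normed_vector) \<Rightarrow> 'm \<Rightarrow> bool" where
  "immersion_at A r X p \<longleftrightarrow> (\<exists>W. open W \<and> p \<in> W \<and> Cr_on A r W X) \<and>
     (\<forall>c\<in>A. p \<in> fst c \<longrightarrow> inj (chart_deriv c X p))"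

definition singular_points :: "('m::topological_space, 'n::finite) chart set \<Rightarrow> nat \<Rightarrow>
    ('m \<Rightarrow> 'b::real_normed_vector) \<Rightarrow> 'm set" where
  "singular_points A r X = {p. \<not> immersion_at A r X p}"

definition is_unit_normal :: "('m, 'n::finite) chart set \<Rightarrow> ('m \<Rightarrow> real ^ 'n option) \<Rightarrow> 'm \<Rightarrow>
    real ^ 'n option \<Rightarrow> bool" where
  "is_unit_normal A X p v \<longleftrightarrow> norm v = 1 \<and>
     (\<forall>c\<in>A. p \<in> fst c \<longrightarrow>
        (\<forall>j. v \<bullet> chart_partial c j X p = 0) \<and> frame_det v (\<lambda>j. chart_partial c j X p) > 0)"

definition unit_normal :: "('m, 'n::finite) chart set \<Rightarrow> ('m \<Rightarrow> real ^ 'n option) \<Rightarrow> 'm \<Rightarrow>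
    real ^ 'n option" where
  "unit_normal A X p = (THE v. is_unit_normal A X p v)"

definition piecewise_weak_immersion :: "('m::topological_space, 'n::finite) chart set \<Rightarrow> nat \<Rightarrow>
    (nat \<Rightarrow> 'm set) \<Rightarrow> nat \<Rightarrow> ('m \<Rightarrow> real ^ 'n option) \<Rightarrow> bool" where
  "piecewise_weak_immersion A k P r X \<longleftrightarrow> continuous_on UNIV X \<and>
     (\<forall>i\<in>{1..k}.
        Cr_on A r (P i) X \<and>
        (\<forall>p\<in>interior (P i). immersion_at A r X p) \<and>
        (\<exists>N. Cr_on A (r - 1) (P i) N \<and> (\<forall>p\<in>P i. norm (N p) = 1) \<and>
             (\<forall>p\<in>interior (P i). is_unit_normal A X p (N p))))"

section \<open>Integration of forms of top degree\<close>

text \<open>A (scalar or complex) \<open>n\<close>-form \<open>\<omega>\<close> on an oriented manifold is given by its coefficient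
  \<open>\<omega> c p\<close> at \<open>p\<close> with respect to \<open>du\<^sup>1 \<and> \<dots> \<and> du\<^sup>n\<close> in each positively oriented chart \<open>c\<close>
  around \<open>p\<close>.  Its integral is computed by cutting the compact manifold into finitely many Borel
  sets whose closures lie in coordinate domains.  By the change of variables formula the result does
  not depend on the cutting, as coefficients of a form in two charts differ by the (positive)
  Jacobian of the transition.\<close>

definition is_chart_partition ::
  "('m::topological_space, 'n::finite) chart set \<Rightarrow> (('m, 'n) chart \<times> 'm set) set \<Rightarrow> bool" where
  "is_chart_partition A \<B> \<longleftrightarrow> finite \<B> \<and>
     (\<forall>(c, B)\<in>\<B>. c \<in> A \<and> B \<in> sets borel \<and> closure B \<subseteq> fst c) \<and>
     (\<Union>(c, B)\<in>\<B>. B) = UNIV \<and> pairwise (\<lambda>x y. disjnt (snd x) (snd y)) \<B>"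

definition chart_partition ::
  "('m::topological_space, 'n::finite) chart set \<Rightarrow> (('m, 'n) chart \<times> 'm set) set" where
  "chart_partition A = (SOME \<B>. is_chart_partition A \<B>)"

definition form_integrable :: "('m::topological_space, 'n::finite) chart set \<Rightarrow> 'm set \<Rightarrow>
    (('m, 'n) chart \<Rightarrow> 'm \<Rightarrow> 'a::{banach, second_countable_topology}) \<Rightarrow> bool" where
  "form_integrable A S \<omega> \<longleftrightarrow> (\<forall>(c, B)\<in>chart_partition A.
     set_integrable lebesgue (snd c ` (B \<inter> S)) (\<lambda>x. \<omega> c (chart_inv c x)))"

definition form_integral :: "('m::topological_space, 'n::finite) chart set \<Rightarrow> 'm set \<Rightarrow>
    (('m, 'n) chart \<Rightarrow> 'm \<Rightarrow> 'a::{banach, second_countable_topology}) \<Rightarrow> 'a" where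
  "form_integral A S \<omega> = (\<Sum>(c, B)\<in>chart_partition A.
     set_lebesgue_integral lebesgue (snd c ` (B \<inter> S)) (\<lambda>x. \<omega> c (chart_inv c x)))"

text \<open>Integration over \<open>M\<close> is summation of the integrals over the pieces.  The forms below are
  defined on the set \<open>D\<close> of regular points of a weak immersion; the singular points lie on the
  boundaries of the pieces and form a null set.\<close>

definition pieces_integrable :: "('m::topological_space, 'n::finite) chart set \<Rightarrow> nat \<Rightarrow>
    (nat \<Rightarrow> 'm set) \<Rightarrow> 'm set \<Rightarrow>
    (('m, 'n) chart \<Rightarrow> 'm \<Rightarrow> 'a::{banach, second_countable_topology}) \<Rightarrow> bool" where
  "pieces_integrable A k P D \<omega> \<longleftrightarrow> (\<forall>i\<in>{1..k}. form_integrable A (P i \<inter> D) \<omega>)"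

definition pieces_integral :: "('m::topological_space, 'n::finite) chart set \<Rightarrow> nat \<Rightarrow>
    (nat \<Rightarrow> 'm set) \<Rightarrow> 'm set \<Rightarrow>
    (('m, 'n) chart \<Rightarrow> 'm \<Rightarrow> 'a::{banach, second_countable_topology}) \<Rightarrow> 'a" where
  "pieces_integral A k P D \<omega> = (\<Sum>i=1..k. form_integral A (P i \<inter> D) \<omega>)"

text \<open>The volume form induced by a hypersurface \<open>Y\<close> with unit normal field \<open>\<nu>\<close>.  For a weak
  immersion and its own unit normal the coefficient is positive, the square root of the Gram
  determinant.  For a parallel hypersurface the unit normal is that of the original hypersurface, and
  the coefficient is negative where this normal and the orientation of \<open>M\<close> do not match.\<close>

definition vol_form :: "('m \<Rightarrow> real ^ 'n option) \<Rightarrow> ('m \<Rightarrow> real ^ 'n option) \<Rightarrow>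
    ('m, 'n::finite) chart \<Rightarrow> 'm \<Rightarrow> real" where
  "vol_form \<nu> Y c p = frame_det (\<nu> p) (\<lambda>j. chart_partial c j Y p)"

section \<open>Anisotropic geometry\<close>

text \<open>The anisotropic energy of a hypersurface \<open>Y\<close> defined on \<open>D\<close> with unit normal field \<open>\<nu>\<close>.\<close>

definition aniso_energy :: "('m::topological_space, 'n::finite) chart set \<Rightarrow> nat \<Rightarrow> (nat \<Rightarrow> 'm set) \<Rightarrow>
    'm set \<Rightarrow> (real ^ 'n option \<Rightarrow> real) \<Rightarrow> ('m \<Rightarrow> real ^ 'n option) \<Rightarrow> ('m \<Rightarrow> real ^ 'n option) \<Rightarrow> real" where
  "aniso_energy A k P D \<gamma> \<nu> Y = pieces_integral A k P D (\<lambda>c p. \<gamma> (\<nu> p) * vol_form \<nu> Y c p)"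

text \<open>The gradient of \<open>\<gamma>\<close> on the unit sphere: the tangent vector representing the differential of
  the restriction of \<open>\<gamma>\<close> to the sphere.\<close>

definition sphere_grad :: "('a::euclidean_space \<Rightarrow> real) \<Rightarrow> 'a \<Rightarrow> 'a" where
  "sphere_grad \<gamma> v =
     (THE g. g \<bullet> v = 0 \<and> (\<gamma> has_derivative (\<lambda>h. g \<bullet> h)) (at v within sphere 0 1))"

definition cahn_hoffman :: "('a::euclidean_space \<Rightarrow> real) \<Rightarrow> 'a \<Rightarrow> 'a" where
  "cahn_hoffman \<gamma> v = sphere_grad \<gamma> v + \<gamma> v *\<^sub>R v"

definition cahn_hoffman_field :: "('m, 'n::finite) chart set \<Rightarrow> (real ^ 'n option \<Rightarrow> real) \<Rightarrow>
    ('m \<Rightarrow> real ^ 'n option) \<Rightarrow> 'm \<Rightarrow> real ^ 'n option" where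
  "cahn_hoffman_field A \<gamma> X p = cahn_hoffman \<gamma> (unit_normal A X p)"

definition aniso_parallel :: "('m, 'n::finite) chart set \<Rightarrow> (real ^ 'n option \<Rightarrow> real) \<Rightarrow>
    ('m \<Rightarrow> real ^ 'n option) \<Rightarrow> real \<Rightarrow> 'm \<Rightarrow> real ^ 'n option" where
  "aniso_parallel A \<gamma> X t p = X p + t *\<^sub>R cahn_hoffman_field A \<gamma> X p"

text \<open>The matrix of the endomorphism \<open>S\<^sup>\<gamma>\<close> of the tangent space, \<open>dX \<circ> S\<^sup>\<gamma> = - d\<xi>\<close>, with respect to
  the coordinate basis of the chart \<open>c\<close>.\<close>

definition aniso_shape_matrix :: "('m, 'n::finite) chart set \<Rightarrow> (real ^ 'n option \<Rightarrow> real) \<Rightarrow>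
    ('m \<Rightarrow> real ^ 'n option) \<Rightarrow> ('m, 'n) chart \<Rightarrow> 'm \<Rightarrow> real ^ 'n ^ 'n" where
  "aniso_shape_matrix A \<gamma> X c p =
     (THE S. \<forall>j. (\<Sum>i\<in>UNIV. S $ i $ j *\<^sub>R chart_partial c i X p) =
                - chart_partial c j (cahn_hoffman_field A \<gamma> X) p)"

definition complex_charpoly :: "real ^ 'n ^ 'n \<Rightarrow> complex poly" where
  "complex_charpoly S = det (mat [:0, 1:] - map_matrix (\<lambda>a. [:complex_of_real a:]) S)"

text \<open>A list of the eigenvalues of \<open>S\<^sup>\<gamma>\<close> with algebraic multiplicity; changing the chart conjugates
  the matrix.  As \<open>\<gamma>\<close> is not assumed convex, \<open>S\<^sup>\<gamma>\<close> is a product of two symmetric operators neither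
  of which need be definite, so its eigenvalues may be non-real.  They come in conjugate pairs, so
  that their symmetric functions are real.\<close>

definition aniso_curvatures :: "('m, 'n::finite) chart set \<Rightarrow> (real ^ 'n option \<Rightarrow> real) \<Rightarrow>
    ('m \<Rightarrow> real ^ 'n option) \<Rightarrow> 'm \<Rightarrow> complex list" where
  "aniso_curvatures A \<gamma> X p =
     (SOME ks. \<exists>c\<in>A. p \<in> fst c \<and> mset ks = proots (complex_charpoly (aniso_shape_matrix A \<gamma> X c p)))"

definition aniso_curvature :: "('m, 'n::finite) chart set \<Rightarrow> (real ^ 'n option \<Rightarrow> real) \<Rightarrow>
    ('m \<Rightarrow> real ^ 'n option) \<Rightarrow> nat \<Rightarrow> 'm \<Rightarrow> complex" where
  "aniso_curvature A \<gamma> X l p = aniso_curvatures A \<gamma> X p ! (l - 1)"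

definition aniso_mean_curvature :: "('m, 'n::finite) chart set \<Rightarrow> (real ^ 'n option \<Rightarrow> real) \<Rightarrow>
    ('m \<Rightarrow> real ^ 'n option) \<Rightarrow> nat \<Rightarrow> 'm \<Rightarrow> complex" where
  "aniso_mean_curvature A \<gamma> X r p =
     (\<Sum>L | L \<subseteq> {1..CARD('n)} \<and> card L = r. \<Prod>l\<in>L. aniso_curvature A \<gamma> X l p)
       / of_nat (CARD('n) choose r)"

end

theory Submission
  imports Defs
begin

text \<open>At a regular point the parallel hypersurface \<open>X + t \<xi>\<close>, where \<open>\<xi>\<close> is the Cahn-Hoffman field of \<open>X\<close>, has the
  tangent vectors \<open>\<partial>\<^sub>j X + t \<partial>\<^sub>j \<xi>\<close>.  The derivative of \<open>\<xi>\<close> is orthogonal to the unit normal \<open>\<nu>\<close>: this comes from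
  differentiating \<open>\<xi> \<bullet> \<nu> = \<gamma>(\<nu>)\<close> (lemma \<open>cahn_hoffman_derivative_tangent\<close>).  Hence \<open>\<partial>\<^sub>j \<xi> = - \<Sum>\<^sub>i S\<^sub>i\<^sub>j \<partial>\<^sub>i X\<close> for a
  unique matrix \<open>S\<close>, the frame \<open>(\<nu>, \<partial>X)\<close> is multiplied by \<open>diag(1, 1 - t S)\<close>, and
  \<open>dA\<^sub>t = det (1 - t S) dA\<close> holds pointwise, with sign (lemma \<open>vol_form_parallel\<close>).  The determinant is
  the reversed characteristic polynomial of \<open>S\<close>, that is, the product of the factors \<open>1 - t \<kappa>\<^sub>l\<close> over the
  complex eigenvalues (lemma \<open>prod_one_minus_eigenvalues\<close>), and expanding this product gives the mean
  curvatures.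

  What remains is to integrate.  The boundary of a piece is a null set, as a finite union of smooth
  images of subsets of hyperplanes (lemma \<open>frontier_negligible\<close>), and all interior points are regular.
  In a chart, \<open>X\<close> and \<open>\<xi>\<close> on the interior of a piece are, near each of its points and boundary points,
  restrictions of \<open>C\<^sup>1\<close> maps defined on a full neighbourhood, so the energy density is continuous on the interior and stays bounded near the boundary, where \<open>X\<close> may be singular
  (lemmas \<open>C1_on_partial_bounded\<close> and \<open>form_integrable_energy\<close>).  This gives the first identity.
  For the second, \<open>\<gamma>(\<nu>)\<close> is continuous and bounded, so if every \<open>H\<^sub>r dA\<close> is integrable then so is every
  \<open>\<gamma>(\<nu>) H\<^sub>r dA\<close>, and the integral of the expanded product may be taken term by term.\<close>

section \<open>Frames of the ambient space\<close>

lemma sum_UNIV_option: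
  fixes f :: "'n::finite option \<Rightarrow> 'a::comm_monoid_add"
  shows "(\<Sum>a\<in>UNIV. f a) = f None + (\<Sum>j\<in>UNIV. f (Some j))"
  by (simp add: UNIV_option_conv sum.reindex)

lemma prod_UNIV_option:
  fixes f :: "'n::finite option \<Rightarrow> 'a::comm_monoid_mult"
  shows "(\<Prod>a\<in>UNIV. f a) = f None * (\<Prod>j\<in>UNIV. f (Some j))"
  by (simp add: UNIV_option_conv prod.reindex)

text \<open>The determinant of a frame of the ambient space involves a matrix indexed by \<open>'n option\<close>.  A change
  of the tangent part of the frame by \<open>T\<close> that keeps the normal is left multiplication by the block
  matrix \<open>diag(1, T)\<close>.\<close>
definition bordered :: "real ^ 'n ^ 'n \<Rightarrow> real ^ 'n option ^ ('n::finite option)" where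
  "bordered T = (\<chi> a b. case a of None \<Rightarrow> (if b = None then 1 else 0)
     | Some i \<Rightarrow> (case b of None \<Rightarrow> 0 | Some j \<Rightarrow> T $ i $ j))"

text \<open>Only permutations fixing \<open>None\<close> contribute, and these are the permutations of \<open>'n\<close> transported
  along \<open>Some\<close>, with the same sign.\<close>
lemma det_bordered: "det (bordered T) = det (T :: real ^ 'n ^ 'n)"
proof -
  let ?P = "{p. p permutes (UNIV :: 'n set)}"
  let ?Q = "{p. p permutes (range (Some :: 'n \<Rightarrow> _))}"
  let ?t = "\<lambda>p. of_int (sign p) * (\<Prod>a\<in>UNIV. bordered T $ a $ p a)"
  have bij: "bij_betw (Some :: 'n \<Rightarrow> _) UNIV (range Some)"
    by (simp add: inj_on_imp_bij_betw)
  have bij': "bij_betw (the :: 'n option \<Rightarrow> _) (range Some) UNIV"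
    by (rule bij_betw_byWitness[where f' = Some]) auto
  have "det (bordered T) = sum ?t {p. p permutes (UNIV :: 'n option set)}"
    by (simp add: det_def)
  also have "\<dots> = sum ?t ?Q"
  proof (rule sum.mono_neutral_right)
    show "?Q \<subseteq> {p. p permutes UNIV}"
      by (auto intro: permutes_subset)
    show "\<forall>p\<in>{p. p permutes UNIV} - ?Q. ?t p = 0"
    proof
      fix p :: "'n option \<Rightarrow> 'n option"
      assume "p \<in> {p. p permutes UNIV} - ?Q"
      then have p: "p permutes UNIV" and nQ: "\<not> p permutes range Some" by auto
      have "p None \<noteq> None"
      proof
        assume "p None = None"
        then have "p permutes range Some"
          using permutes_superset[OF p, of "range Some"] by (metis DiffE UNIV_option_conv insertE)
        then show False using nQ by simp
      qed
      then show "?t p = 0"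
        by (auto simp: prod_UNIV_option bordered_def)
    qed
  qed (simp add: finite_permutations)
  also have "\<dots> = (\<Sum>p\<in>?P. of_int (sign p) * (\<Prod>i\<in>UNIV. T $ i $ p i))"
  proof (rule sum.reindex_bij_witness[where j = "map_permutation (range Some) the"
        and i = "map_permutation UNIV Some"])
    fix p :: "'n \<Rightarrow> 'n" assume "p \<in> ?P"
    then have p: "p permutes UNIV" by simp
    show "map_permutation UNIV Some p \<in> ?Q"
      using map_permutation_permutes[OF bij p] by simp
    show "map_permutation (range Some) the (map_permutation UNIV Some p) = p"
      using p by (intro map_permutation_compose_inv[OF bij]) auto
  next
    fix q :: "'n option \<Rightarrow> 'n option" assume "q \<in> ?Q"
    then have q: "q permutes range Some" by simp
    show "map_permutation (range Some) the q \<in> ?P"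
      using map_permutation_permutes[OF bij' q] by simp
    show "map_permutation UNIV Some (map_permutation (range Some) the q) = q"
      using q by (intro map_permutation_compose_inv[OF bij']) auto
    have inj: "inj_on the (range (Some :: 'n \<Rightarrow> _))" by (auto simp: inj_on_def)
    have "q None = None" using q by (simp add: permutes_def)
    moreover have "q (Some i) = Some (map_permutation (range Some) the q i)" for i
    proof -
      have "map_permutation (range Some) the q (the (Some i)) = the (q (Some i))"
        by (rule map_permutation_apply[OF inj]) simp
      moreover have "q (Some i) \<in> range Some"
        using permutes_in_image[OF q, of "Some i"] by simp
      ultimately show ?thesis by force
    qed
    ultimately show "of_int (sign (map_permutation (range Some) the q)) *
        (\<Prod>i\<in>UNIV. T $ i $ map_permutation (range Some) the q i) = ?t q"
      using sign_map_permutation[OF inj q] by (simp add: prod_UNIV_option bordered_def)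
  qed
  finally show ?thesis by (simp add: det_def)
qed

lemma frame_det_linear:
  "frame_det v (\<lambda>j. \<Sum>i\<in>UNIV. T $ i $ j *\<^sub>R w i) = det T * frame_det v w"
proof -
  let ?M = "(\<chi> a. case a of None \<Rightarrow> v | Some j \<Rightarrow> w j)"
  have "bordered (transpose T) ** ?M =
      (\<chi> a. case a of None \<Rightarrow> v | Some j \<Rightarrow> \<Sum>i\<in>UNIV. T $ i $ j *\<^sub>R w i)"
    by (auto simp: vec_eq_iff matrix_matrix_mult_def bordered_def sum_UNIV_option transpose_def
        split: option.split)
  then show ?thesis
    unfolding frame_det_def by (metis det_bordered det_mul det_transpose)
qed

lemma frame_det_scale_normal: "frame_det (a *\<^sub>R v) w = a * frame_det v w"
proof -
  have "frame_det (a *\<^sub>R v) w =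
      det (\<chi> i. if i = None then a *s v else (case i of None \<Rightarrow> v | Some j \<Rightarrow> w j))"
    unfolding frame_det_def
    by (rule arg_cong[where f = det]) (auto simp: vec_eq_iff split: option.split)
  also have "\<dots> = a * det (\<chi> i. if i = None then v else (case i of None \<Rightarrow> v | Some j \<Rightarrow> w j))"
    by (subst det_row_mul) simp
  also have "(\<chi> i. if i = None then v else (case i of None \<Rightarrow> v | Some j \<Rightarrow> w j)) =
      (\<chi> i. case i of None \<Rightarrow> v | Some j \<Rightarrow> w j)"
    by (auto simp: vec_eq_iff split: option.split)
  finally show ?thesis by (simp add: frame_det_def)
qed

lemma orthogonal_to_frame_eq_0:
  assumes "frame_det v w \<noteq> 0" and "u \<bullet> v = 0" and "\<And>j. u \<bullet> w j = 0"
  shows "u = 0"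
proof -
  let ?M = "(\<chi> a. case a of None \<Rightarrow> v | Some j \<Rightarrow> w j)"
  have "invertible ?M"
    using assms(1) by (simp add: frame_det_def invertible_det_nz)
  moreover have "?M *v u = 0"
    using assms(2,3) by (auto simp: vec_eq_iff matrix_vector_mult_def inner_vec_def mult.commute
        split: option.split)
  ultimately show ?thesis
    by (metis matrix_left_invertible_ker invertible_def)
qed

text \<open>A vector orthogonal to the tangent part is a multiple of the normal, the length determines the
  factor up to sign, and the orientation determines the sign.\<close>
lemma normal_to_frame_unique:
  assumes "frame_det v w > 0" "norm v = 1" "\<And>j. v \<bullet> w j = 0"
    and "frame_det v' w > 0" "norm v' = 1" "\<And>j. v' \<bullet> w j = 0"
  shows "v' = v"
proof -
  have "v' - (v' \<bullet> v) *\<^sub>R v = 0"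
    by (rule orthogonal_to_frame_eq_0[of v w])
      (use assms in \<open>auto simp: inner_diff_left norm_eq_1\<close>)
  then have v': "v' = (v' \<bullet> v) *\<^sub>R v" by simp
  then have "\<bar>v' \<bullet> v\<bar> = 1"
    using assms(2,5) by (metis mult.right_neutral norm_scaleR)
  moreover have "v' \<bullet> v > 0"
    using assms(1,4) v' by (metis frame_det_scale_normal zero_less_mult_pos2)
  ultimately show ?thesis using v' by simp
qed

lemma tangent_expansion:
  assumes "frame_det v w \<noteq> 0" and v: "norm v = 1" "\<And>j. v \<bullet> w j = 0" and "v \<bullet> u = 0"
  shows "\<exists>s :: real ^ 'n. u = (\<Sum>i\<in>UNIV. s $ i *\<^sub>R w (i :: 'n::finite))"
proof -
  let ?M = "(\<chi> a. case a of None \<Rightarrow> v | Some j \<Rightarrow> w j)"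
  have "invertible (transpose ?M)"
    using assms(1) by (simp add: frame_det_def invertible_det_nz)
  then obtain c where c: "transpose ?M *v c = u"
    by (metis invertible_def matrix_vector_mul_assoc matrix_vector_mul_lid)
  have u: "u = c $ None *\<^sub>R v + (\<Sum>i\<in>UNIV. c $ Some i *\<^sub>R w i)"
    unfolding c[symmetric]
    by (simp add: vec_eq_iff matrix_vector_mult_def transpose_def sum_UNIV_option mult.commute)
  have "v \<bullet> u = c $ None"
    using v unfolding u by (simp add: inner_add_right inner_sum_right norm_eq_1)
  with assms(4) u have "u = (\<Sum>i\<in>UNIV. (\<chi> i. c $ Some i) $ i *\<^sub>R w i)" by simp
  then show ?thesis by blast
qed

lemma frame_independent:
  fixes s :: "real ^ 'n::finite"
  assumes "frame_det v w \<noteq> 0" and "(\<Sum>i\<in>UNIV. s $ i *\<^sub>R w i) = 0"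
  shows "s = 0"
proof -
  let ?M = "(\<chi> a. case a of None \<Rightarrow> v | Some j \<Rightarrow> w j)"
  let ?c = "(\<chi> a. case a of None \<Rightarrow> 0 | Some j \<Rightarrow> s $ j) :: real ^ 'n option"
  have "invertible (transpose ?M)"
    using assms(1) by (simp add: frame_det_def invertible_det_nz)
  moreover have "transpose ?M *v ?c = (\<Sum>i\<in>UNIV. s $ i *\<^sub>R w i)"
    by (simp add: vec_eq_iff matrix_vector_mult_def transpose_def sum_UNIV_option mult.commute)
  ultimately have "?c = 0"
    using assms(2) by (metis matrix_left_invertible_ker invertible_def)
  then show ?thesis by (simp add: vec_eq_iff split: option.splits)
qed

text \<open>The shape matrix is well defined because the tangent frame is a basis of the orthogonal complement of
  the normal.\<close>
lemma tangent_endomorphism_matrix: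
  assumes fr: "frame_det v w \<noteq> 0" and v: "norm v = 1" "\<And>j. v \<bullet> w j = 0"
    and u: "\<And>j. v \<bullet> u j = 0"
  shows "\<exists>!S :: real ^ 'n ^ 'n. \<forall>j. (\<Sum>i\<in>UNIV. S $ i $ j *\<^sub>R w (i :: 'n::finite)) = u j"
proof -
  have "\<forall>j. \<exists>s :: real ^ 'n. u j = (\<Sum>i\<in>UNIV. s $ i *\<^sub>R w i)"
    using tangent_expansion[OF fr v u] by blast
  then obtain s :: "'n \<Rightarrow> real ^ 'n" where s: "\<And>j. u j = (\<Sum>i\<in>UNIV. s j $ i *\<^sub>R w i)"
    by metis
  show ?thesis
  proof (rule ex1I)
    show "\<forall>j. (\<Sum>i\<in>UNIV. (\<chi> i j. s j $ i) $ i $ j *\<^sub>R w i) = u j"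
      by (simp add: s)
  next
    fix S :: "real ^ 'n ^ 'n" assume S: "\<forall>j. (\<Sum>i\<in>UNIV. S $ i $ j *\<^sub>R w i) = u j"
    have "(\<chi> i. S $ i $ j - s j $ i) = 0" for j
      by (rule frame_independent[OF fr])
        (use S s in \<open>simp add: scaleR_left_diff_distrib sum_subtractf\<close>)
    then show "S = (\<chi> i j. s j $ i)" by (simp add: vec_eq_iff)
  qed
qed

section \<open>The eigenvalues of a real matrix\<close>

lemma poly_complex_charpoly:
  "poly (complex_charpoly S) z = det (mat z - map_matrix complex_of_real S)"
  by (simp add: complex_charpoly_def det_def poly_sum poly_prod mat_def if_distrib[of "\<lambda>p. poly p z"]
      map_matrix_def cong: if_cong)

text \<open>The identity contributes a monic polynomial of degree \<open>n\<close> to the Leibniz formula.  Any other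
  permutation \<open>p\<close> contributes a factor of positive degree only at its fixed points, of which there
  are fewer than \<open>n\<close>.\<close>
lemma complex_charpoly_monic:
  fixes S :: "real ^ 'n ^ 'n"
  shows "degree (complex_charpoly S) = CARD('n)" and "lead_coeff (complex_charpoly S) = 1"
proof -
  let ?e = "\<lambda>(p :: 'n \<Rightarrow> 'n) i. (mat [:0, 1:] - map_matrix (\<lambda>a. [:complex_of_real a:]) S) $ i $ p i"
  let ?t = "\<lambda>p. of_int (sign p) * (\<Prod>i\<in>UNIV. ?e p i)"
  let ?P = "{p. p permutes (UNIV :: 'n set)}"
  have e: "?e p i = (if p i = i then [:- complex_of_real (S $ i $ i), 1:]
      else [:- complex_of_real (S $ i $ p i):])" for p i
    by (auto simp: mat_def map_matrix_def)
  have deg: "degree (\<Prod>i\<in>UNIV. ?e p i) \<le> card {i. p i = i}" for p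
  proof -
    have "degree (\<Prod>i\<in>UNIV. ?e p i) \<le> (\<Sum>i\<in>UNIV. degree (?e p i))"
      using degree_prod_sum_le[of UNIV "?e p"] by (simp add: o_def)
    also have "\<dots> = (\<Sum>i\<in>UNIV. if p i = i then 1 else 0)"
      by (rule sum.cong) (simp_all only: e, auto)
    also have "\<dots> = card {i. p i = i}"
      by (simp add: sum.If_cases)
    finally show ?thesis .
  qed
  have of_int: "coeff (of_int (sign p) * q) n = of_int (sign p) * coeff q n" for p :: "'n \<Rightarrow> 'n" and q :: "complex poly" and n
    by (simp add: sign_def)
  have char: "coeff (complex_charpoly S) n = (\<Sum>p\<in>?P. of_int (sign p) * coeff (\<Prod>i\<in>UNIV. ?e p i) n)" for n
    unfolding complex_charpoly_def det_def coeff_sum of_int ..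
  have id: "(\<Prod>i\<in>UNIV. ?e id i) = (\<Prod>i\<in>UNIV. [:- complex_of_real (S $ i $ i), 1:])"
    by (rule prod.cong) (simp_all only: e[where p = id, unfolded id_apply] simp_thms if_True id_apply)
  have degid: "degree (\<Prod>i\<in>UNIV. ?e id i) = CARD('n)"
    unfolding id by (subst degree_prod_eq_sum_degree) auto
  have lcid: "coeff (\<Prod>i\<in>UNIV. ?e id i) CARD('n) = 1"
  proof -
    have "lead_coeff (\<Prod>i\<in>UNIV. ?e id i) = 1"
      unfolding id by (subst lead_coeff_prod) simp
    then show ?thesis using degid by metis
  qed
  have top: "coeff (complex_charpoly S) CARD('n) = 1"
  proof -
    have "coeff (\<Prod>i\<in>UNIV. ?e p i) CARD('n) = 0" if "p \<noteq> id" for p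
    proof -
      have "card {i. p i = i} < CARD('n)"
        using that by (intro psubset_card_mono) (auto simp: fun_eq_iff)
      then show ?thesis using deg[of p] by (intro coeff_eq_0) linarith
    qed
    then have "coeff (complex_charpoly S) CARD('n) =
        (\<Sum>p\<in>?P. if p = id then of_int (sign p) * coeff (\<Prod>i\<in>UNIV. ?e p i) CARD('n) else 0)"
      unfolding char by (intro sum.cong refl) auto
    also have "\<dots> = 1"
      using lcid by (subst sum.delta) (auto simp: permutes_id finite_permutations)
    finally show ?thesis .
  qed
  have above: "coeff (complex_charpoly S) n = 0" if "n > CARD('n)" for n
  proof -
    have "coeff (\<Prod>i\<in>UNIV. ?e p i) n = 0" for p
    proof -
      have "card {i. p i = i} \<le> CARD('n)" by (intro card_mono) auto
      then show ?thesis using deg[of p] that by (intro coeff_eq_0) linarith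
    qed
    then show ?thesis unfolding char by simp
  qed
  show "degree (complex_charpoly S) = CARD('n)"
    by (rule antisym[OF degree_le le_degree]) (use top above in auto)
  then show "lead_coeff (complex_charpoly S) = 1" using top by simp
qed

lemma prod_list_conv_prod_shift:
  "prod_list (map f xs) = (\<Prod>l=1..length xs. f (xs ! (l - 1)))"
proof -
  have "prod_list (map f xs) = (\<Prod>l<length xs. f (xs ! l))"
    by (induction xs rule: rev_induct) (auto simp: nth_append)
  also have "\<dots> = (\<Prod>l=1..length xs. f (xs ! (l - 1)))"
    by (rule prod.reindex_bij_witness[where i = "\<lambda>l. l - 1" and j = Suc]) auto
  finally show ?thesis .
qed

text \<open>For \<open>t \<noteq> 0\<close> both sides are \<open>t ^ n\<close> times the characteristic polynomial at \<open>1 / t\<close>: the left one by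
  factorisation over the complex numbers, the right one by pulling \<open>t\<close> out of each row.  The monic
  normalisation guarantees that there are exactly \<open>n\<close> eigenvalues.\<close>
lemma prod_one_minus_eigenvalues:
  fixes S :: "real ^ 'n ^ 'n"
  assumes ks: "mset ks = proots (complex_charpoly S)"
  shows "(\<Prod>l=1..CARD('n). 1 - complex_of_real t * ks ! (l - 1)) =
    complex_of_real (det (mat 1 - t *\<^sub>R S))"
proof -
  let ?\<chi> = "complex_charpoly S" and ?z = "1 / complex_of_real t"
  have len: "length ks = CARD('n)"
    using ks complex_charpoly_monic(1)[of S] size_proots_complex[of ?\<chi>] by (metis size_mset)
  have "(\<Prod>l=1..CARD('n). 1 - complex_of_real t * ks ! (l - 1)) =
      complex_of_real t ^ CARD('n) * (\<Prod>l=1..CARD('n). ?z - ks ! (l - 1))" if "t \<noteq> 0"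
  proof -
    have "1 - complex_of_real t * x = complex_of_real t * (?z - x)" for x
      using that by (simp add: field_simps)
    then show ?thesis by (simp only: prod.distrib) simp
  qed
  moreover have "(\<Prod>l=1..CARD('n). ?z - ks ! (l - 1)) = poly ?\<chi> ?z"
  proof -
    have "?\<chi> = (\<Prod>x\<in>#proots ?\<chi>. [:-x, 1:])"
      using complex_poly_decompose_multiset[of ?\<chi>] complex_charpoly_monic(2)[of S] by simp
    then have "poly ?\<chi> ?z = poly (\<Prod>x\<leftarrow>ks. [:-x, 1:]) ?z"
      by (simp flip: ks prod_mset_prod_list)
    also have "\<dots> = (\<Prod>l=1..length ks. ?z - ks ! (l - 1))"
      by (simp add: prod_list_conv_prod_shift poly_prod)
    finally show ?thesis using len by simp
  qed
  moreover have "complex_of_real t ^ CARD('n) * poly ?\<chi> ?z = complex_of_real (det (mat 1 - t *\<^sub>R S))"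
    if "t \<noteq> 0"
  proof -
    have "complex_of_real t ^ CARD('n) * poly ?\<chi> ?z =
        det (\<chi> i. complex_of_real t *s (mat ?z - map_matrix complex_of_real S) $ i)"
      unfolding poly_complex_charpoly by (subst det_rows_mul) simp
    also have "(\<chi> i. complex_of_real t *s (mat ?z - map_matrix complex_of_real S) $ i) =
        map_matrix complex_of_real (mat 1 - t *\<^sub>R S)"
      using that by (simp add: vec_eq_iff mat_def map_matrix_def field_simps)
    also have "det \<dots> = complex_of_real (det (mat 1 - t *\<^sub>R S))"
      by (simp add: det_def map_matrix_def)
    finally show ?thesis .
  qed
  ultimately show ?thesis by (cases "t = 0") auto
qed

text \<open>Elementary symmetric functions appear by expanding the product and sorting the subsets of indices
  by cardinality.\<close>
lemma prod_one_minus_eq_sum: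
  fixes \<kappa> :: "nat \<Rightarrow> 'a::comm_ring_1"
  shows "(\<Prod>l=1..n. 1 - s * \<kappa> l) =
    (\<Sum>r=0..n. (- 1) ^ r * s ^ r * (\<Sum>L | L \<subseteq> {1..n} \<and> card L = r. \<Prod>l\<in>L. \<kappa> l))"
proof -
  have "(\<Prod>l=1..n. 1 - s * \<kappa> l) = (\<Prod>l=1..n. (- s) * \<kappa> l + 1)"
    by (intro prod.cong) auto
  also have "\<dots> = (\<Sum>L\<in>Pow {1..n}. (- s) ^ card L * (\<Prod>l\<in>L. \<kappa> l))"
    by (subst prod_add) (simp_all only: prod.distrib finite_atLeastAtMost prod_constant prod.neutral_const mult_1_right power_one)
  also have "\<dots> = (\<Sum>r=0..n. \<Sum>L | L \<in> Pow {1..n} \<and> card L = r. (- s) ^ card L * (\<Prod>l\<in>L. \<kappa> l))"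
  proof (rule sum.group[symmetric])
    show "card ` Pow {1..n} \<subseteq> {0..n}"
      using card_mono[of "{1..n}"] by fastforce
  qed auto
  also have "\<dots> = (\<Sum>r=0..n. (- s) ^ r * (\<Sum>L | L \<subseteq> {1..n} \<and> card L = r. \<Prod>l\<in>L. \<kappa> l))"
    by (intro sum.cong refl) (auto simp: sum_distrib_left intro!: sum.cong)
  finally show ?thesis by (simp only: power_minus[of s])
qed

section \<open>Maps of class \<open>C\<^sup>1\<close>\<close>

text \<open>The recursive equation is kept out of the simplifier: otherwise every \<open>C\<^sup>1\<close> hypothesis is
  dissolved into conditions on partial derivatives.\<close>

declare Ck_open.simps(2) [simp del]

lemma Ck_open_subset: "Ck_open k S f \<Longrightarrow> T \<subseteq> S \<Longrightarrow> Ck_open k T f"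
  by (induction k arbitrary: f) (auto simp: Ck_open.simps intro: continuous_on_subset)

lemma Ck_open_SucD: "Ck_open (Suc k) S f \<Longrightarrow> Ck_open k S f"
proof (induction k arbitrary: f)
  case 0
  then show ?case
    by (auto simp: Ck_open.simps intro!: differentiable_imp_continuous_on differentiable_at_imp_differentiable_on)
next
  case (Suc k)
  have "Ck_open (Suc k) S (\<lambda>x. frechet_derivative f (at x) v)" for v
    using Suc.prems Ck_open.simps(2)[of "Suc k" S f] by simp
  then have "Ck_open k S (\<lambda>x. frechet_derivative f (at x) v)" for v
    by (rule Suc.IH)
  then show ?case
    using Suc.prems Ck_open.simps(2)[of "Suc k" S f] Ck_open.simps(2)[of k S f] by simp
qed

lemma Ck_on_SucD: "Ck_on (Suc k) S f \<Longrightarrow> Ck_on k S f"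
  unfolding Ck_on_def by (intro ballI) (drule (1) bspec, elim exE conjE, drule Ck_open_SucD, blast)

text \<open>For \<open>C\<^sup>1\<close> it is enough to exhibit some derivative with continuous directional derivatives; this form
  is used for the closure properties below.\<close>
lemma C1_openI:
  assumes "\<And>x. x \<in> S \<Longrightarrow> (f has_derivative f' x) (at x)"
    and "\<And>v. continuous_on S (\<lambda>x. f' x v)"
  shows "Ck_open 1 S f"
proof -
  have "frechet_derivative f (at x) = f' x" if "x \<in> S" for x
    using frechet_derivative_at[OF assms(1)[OF that]] by simp
  then have "continuous_on S (\<lambda>x. frechet_derivative f (at x) v)" for v
    using assms(2)[of v] by (simp cong: continuous_on_cong)
  then show ?thesis using assms(1) by (auto simp: differentiable_def Ck_open.simps)
qed

lemma C1_openE: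
  assumes "Ck_open 1 S f"
  obtains f' where "\<And>x. x \<in> S \<Longrightarrow> (f has_derivative f' x) (at x)"
    and "\<And>v. continuous_on S (\<lambda>x. f' x v)" and "continuous_on S f"
proof (rule that[of "\<lambda>x. frechet_derivative f (at x)"])
  show "continuous_on S f" using Ck_open_SucD[of 0 S f] assms by simp
qed (use assms in \<open>auto simp: Ck_open.simps frechet_derivative_works\<close>)

lemma (in bounded_bilinear) C1_open:
  assumes f: "Ck_open 1 S f" and g: "Ck_open 1 S g"
  shows "Ck_open 1 S (\<lambda>x. prod (f x) (g x))"
proof -
  obtain f' where f': "\<And>x. x \<in> S \<Longrightarrow> (f has_derivative f' x) (at x)"
    "\<And>v. continuous_on S (\<lambda>x. f' x v)" "continuous_on S f" using f by (rule C1_openE) blast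
  obtain g' where g': "\<And>x. x \<in> S \<Longrightarrow> (g has_derivative g' x) (at x)"
    "\<And>v. continuous_on S (\<lambda>x. g' x v)" "continuous_on S g" using g by (rule C1_openE) blast
  show ?thesis
  proof (rule C1_openI)
    fix x assume "x \<in> S"
    then show "((\<lambda>x. prod (f x) (g x)) has_derivative
        (\<lambda>h. prod (f x) (g' x h) + prod (f' x h) (g x))) (at x)"
      by (intro FDERIV f' g')
  next
    fix v
    show "continuous_on S (\<lambda>x. prod (f x) (g' x v) + prod (f' x v) (g x))"
      by (intro continuous_on_add continuous_on f' g')
  qed
qed

lemma C1_open_add:
  assumes f: "Ck_open 1 S f" and g: "Ck_open 1 S g"
  shows "Ck_open 1 S (\<lambda>x. f x + g x)"
proof -
  obtain f' where f': "\<And>x. x \<in> S \<Longrightarrow> (f has_derivative f' x) (at x)"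
    "\<And>v. continuous_on S (\<lambda>x. f' x v)" using f by (rule C1_openE) blast
  obtain g' where g': "\<And>x. x \<in> S \<Longrightarrow> (g has_derivative g' x) (at x)"
    "\<And>v. continuous_on S (\<lambda>x. g' x v)" using g by (rule C1_openE) blast
  show ?thesis
    by (rule C1_openI[where f' = "\<lambda>x h. f' x h + g' x h"])
      (auto intro!: f' g' has_derivative_add continuous_on_add)
qed

lemma C1_open_const: "Ck_open 1 S (\<lambda>x. c)"
  by (rule C1_openI[where f' = "\<lambda>_ _. 0"]) auto

lemma C1_open_ident: "Ck_open 1 S (\<lambda>x. x)"
  by (rule C1_openI[where f' = "\<lambda>_ h. h"]) auto

lemma C1_open_sum: "(\<And>b. b \<in> I \<Longrightarrow> Ck_open 1 S (f b)) \<Longrightarrow> Ck_open 1 S (\<lambda>x. \<Sum>b\<in>I. f b x)"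
  by (induction I rule: infinite_finite_induct) (simp_all only: sum.infinite sum.empty sum.insert C1_open_const C1_open_add insert_iff simp_thms)

lemma C1_open_compose:
  fixes f :: "'a::real_normed_vector \<Rightarrow> 'b::euclidean_space" and g :: "'b \<Rightarrow> 'c::real_normed_vector"
  assumes f: "Ck_open 1 S f" and g: "Ck_open 1 T g" and ST: "f ` S \<subseteq> T"
  shows "Ck_open 1 S (g \<circ> f)"
proof -
  obtain f' where f': "\<And>x. x \<in> S \<Longrightarrow> (f has_derivative f' x) (at x)"
    "\<And>v. continuous_on S (\<lambda>x. f' x v)" "continuous_on S f" using f by (rule C1_openE) blast
  obtain g' where g': "\<And>x. x \<in> T \<Longrightarrow> (g has_derivative g' x) (at x)"
    "\<And>v. continuous_on T (\<lambda>x. g' x v)" using g by (rule C1_openE) blast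
  show ?thesis
  proof (rule C1_openI)
    fix x assume "x \<in> S"
    then show "((g \<circ> f) has_derivative (g' (f x) \<circ> f' x)) (at x)"
      using ST by (intro diff_chain_at f' g') auto
  next
    fix v
    \<comment> \<open>Only directional derivatives in fixed directions are known to be continuous, while \<open>f' x v\<close>
        moves with \<open>x\<close>; expanding it in the basis separates the two dependencies.\<close>
    have "continuous_on S (\<lambda>x. \<Sum>b\<in>Basis. (f' x v \<bullet> b) *\<^sub>R g' (f x) b)"
      by (intro continuous_intros f' continuous_on_compose2[OF g'(2) f'(3) ST])
    moreover have "(g' (f x) \<circ> f' x) v = (\<Sum>b\<in>Basis. (f' x v \<bullet> b) *\<^sub>R g' (f x) b)" if "x \<in> S" for x
    proof -
      have "linear (g' (f x))"
        using g'(1)[of "f x"] that ST by (auto intro: has_derivative_linear)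
      then have "g' (f x) (\<Sum>b\<in>Basis. (f' x v \<bullet> b) *\<^sub>R b) = (\<Sum>b\<in>Basis. (f' x v \<bullet> b) *\<^sub>R g' (f x) b)"
        by (simp add: linear_sum linear_cmul)
      then show ?thesis by (simp add: euclidean_representation)
    qed
    ultimately show "continuous_on S (\<lambda>x. (g' (f x) \<circ> f' x) v)"
      by (simp cong: continuous_on_cong)
  qed
qed

lemma C1_on_add:
  assumes "Ck_on 1 S f" "Ck_on 1 S g"
  shows "Ck_on 1 S (\<lambda>x. f x + g x)"
  unfolding Ck_on_def
proof
  fix x assume x: "x \<in> S"
  obtain V f1 where V: "open V" "x \<in> V" "Ck_open 1 V f1" "\<forall>y\<in>S \<inter> V. f1 y = f y"
    using assms(1) x unfolding Ck_on_def by blast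
  obtain W g1 where W: "open W" "x \<in> W" "Ck_open 1 W g1" "\<forall>y\<in>S \<inter> W. g1 y = g y"
    using assms(2) x unfolding Ck_on_def by blast
  have "Ck_open 1 (V \<inter> W) (\<lambda>x. f1 x + g1 x)"
    using V(3) W(3) by (intro C1_open_add) (auto intro: Ck_open_subset)
  then show "\<exists>W h. open W \<and> x \<in> W \<and> Ck_open 1 W h \<and> (\<forall>y\<in>S \<inter> W. h y = f y + g y)"
    using V W by (intro exI[of _ "V \<inter> W"] exI[of _ "\<lambda>x. f1 x + g1 x"]) auto
qed

lemma C1_on_compose:
  fixes f :: "'a::real_normed_vector \<Rightarrow> 'b::euclidean_space" and g :: "'b \<Rightarrow> 'c::real_normed_vector"
  assumes f: "Ck_on 1 S f" and g: "Ck_on 1 T g" and ST: "f ` S \<subseteq> T"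
  shows "Ck_on 1 S (g \<circ> f)"
  unfolding Ck_on_def
proof
  fix x assume x: "x \<in> S"
  obtain V f1 where V: "open V" "x \<in> V" "Ck_open 1 V f1" "\<forall>y\<in>S \<inter> V. f1 y = f y"
    using f x unfolding Ck_on_def by blast
  obtain W g1 where W: "open W" "f x \<in> W" "Ck_open 1 W g1" "\<forall>y\<in>T \<inter> W. g1 y = g y"
    using g x ST unfolding Ck_on_def by blast
  let ?U = "V \<inter> f1 -` W"
  have "continuous_on V f1" using V(3) by (rule C1_openE) blast
  then have "open ?U" using V(1) W(1) by (simp add: continuous_on_open_vimage Int_commute)
  moreover have "Ck_open 1 ?U (g1 \<circ> f1)"
    using V(3) W(3) by (intro C1_open_compose[of ?U f1 W]) (auto intro: Ck_open_subset)
  ultimately show "\<exists>W h. open W \<and> x \<in> W \<and> Ck_open 1 W h \<and> (\<forall>y\<in>S \<inter> W. h y = (g \<circ> f) y)"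
    using x V W ST by (intro exI[of _ ?U] exI[of _ "g1 \<circ> f1"]) (auto simp: image_subset_iff)
qed

lemma C1_on_linear:
  fixes f :: "'a::real_normed_vector \<Rightarrow> 'b::euclidean_space"
  assumes "bounded_linear L" "Ck_on 1 S f"
  shows "Ck_on 1 S (\<lambda>x. L (f x))"
proof -
  have "Ck_open 1 UNIV L"
    by (rule C1_openI[where f' = "\<lambda>_. L"]) (auto intro: bounded_linear_imp_has_derivative assms)
  then have "Ck_on 1 UNIV L" unfolding Ck_on_def by (metis UNIV_I open_UNIV)
  then show ?thesis using C1_on_compose[OF assms(2), of UNIV L] by (simp add: o_def)
qed

lemma Ck_on_imp_continuous_on: "Ck_on k S f \<Longrightarrow> continuous_on S f"
proof (induction k)
  case 0
  show ?case
    unfolding continuous_on_eq_continuous_within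
  proof
    fix x assume x: "x \<in> S"
    obtain W g where W: "open W" "x \<in> W" "continuous_on W g" "\<forall>y\<in>S \<inter> W. g y = f y"
      using 0 x unfolding Ck_on_def by auto
    have "continuous_on (S \<inter> W) f"
      by (rule continuous_on_eq[of _ g]) (use W(3,4) in \<open>auto intro: continuous_on_subset\<close>)
    then have "continuous (at x within (S \<inter> W)) f"
      using x W(2) by (simp add: continuous_on_eq_continuous_within)
    moreover have "at x within S = at x within (S \<inter> W)"
      by (rule at_within_nhd[OF W(2,1)]) auto
    ultimately show "continuous (at x within S) f" by simp
  qed
qed (use Ck_on_SucD in blast)

text \<open>At interior points the derivative of \<open>f\<close> is that of a local \<open>C\<^sup>1\<close> extension, so it has a continuous
  extension to a neighbourhood of every point of \<open>S\<close>, boundary points included.\<close>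
lemma C1_on_local_partials:
  assumes "Ck_on 1 S f" "x0 \<in> S"
  obtains W F where "open W" "x0 \<in> W" "\<And>v. continuous_on W (F v)"
    "\<And>x. x \<in> W \<inter> interior S \<Longrightarrow> (f has_derivative (\<lambda>v. F v x)) (at x)"
proof -
  obtain W g where W: "open W" "x0 \<in> W" "Ck_open 1 W g" "\<forall>y\<in>S \<inter> W. g y = f y"
    using assms unfolding Ck_on_def by blast
  obtain g' where g': "\<And>x. x \<in> W \<Longrightarrow> (g has_derivative g' x) (at x)"
    "\<And>v. continuous_on W (\<lambda>x. g' x v)" using W(3) by (rule C1_openE) blast
  show ?thesis
  proof (rule that[OF W(1,2) g'(2)])
    fix x assume x: "x \<in> W \<inter> interior S"
    have "(f has_derivative g' x) (at x)"
    proof (rule has_derivative_transform_within_open)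
      show "(g has_derivative g' x) (at x)" using g' x by simp
      show "open (W \<inter> interior S)" using W(1) by (simp add: open_Int)
    qed (use x W(4) interior_subset in auto)
    then show "(f has_derivative (\<lambda>v. g' x v)) (at x)" by simp
  qed
qed

lemma C1_on_differentiable_interior:
  assumes "Ck_on 1 S f" "x \<in> interior S"
  shows "f differentiable (at x)"
proof -
  have "x \<in> S" using assms(2) interior_subset by blast
  then obtain W F where "x \<in> W"
    "\<And>x. x \<in> W \<inter> interior S \<Longrightarrow> (f has_derivative (\<lambda>v. F v x)) (at x)"
    by (rule C1_on_local_partials[OF assms(1)]) blast
  then show ?thesis using assms(2) unfolding differentiable_def by blast
qed

lemma C1_on_partial_continuous:
  assumes "Ck_on 1 S f"
  shows "continuous_on (interior S) (\<lambda>x. frechet_derivative f (at x) v)"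
  unfolding continuous_on_eq_continuous_at[OF open_interior]
proof
  fix x assume x: "x \<in> interior S"
  then have "x \<in> S" using interior_subset by blast
  then obtain W F where W: "open W" "x \<in> W" "\<And>v. continuous_on W (F v)"
    "\<And>x. x \<in> W \<inter> interior S \<Longrightarrow> (f has_derivative (\<lambda>v. F v x)) (at x)"
    by (rule C1_on_local_partials[OF assms]) blast
  have "frechet_derivative f (at y) v = F v y" if "y \<in> W \<inter> interior S" for y
    using frechet_derivative_at[OF W(4)[OF that]] by metis
  moreover have "continuous_on (W \<inter> interior S) (F v)"
    using W(3) continuous_on_subset by blast
  ultimately have "continuous_on (W \<inter> interior S) (\<lambda>x. frechet_derivative f (at x) v)"
    by (metis (mono_tags, lifting) continuous_on_cong)
  then show "isCont (\<lambda>x. frechet_derivative f (at x) v) x"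
    using x W(1,2) by (simp add: continuous_on_eq_continuous_at open_Int)
qed

text \<open>The derivative of \<open>f\<close> need not exist at boundary points of \<open>S\<close>, but its values at interior points do not
  blow up there.  This is what makes the area of a piece finite although the map may be singular on
  the boundary of the piece.\<close>
lemma C1_on_partial_bounded:
  assumes "Ck_on 1 S f" "compact K" "K \<subseteq> S"
  shows "\<exists>C. \<forall>x\<in>K \<inter> interior S. norm (frechet_derivative f (at x) v) \<le> C"
proof -
  define bounded_by where "bounded_by C W \<longleftrightarrow>
    (\<forall>y\<in>W \<inter> interior S. norm (frechet_derivative f (at y) v) \<le> C)" for C W
  have "\<exists>W C. open W \<and> x \<in> W \<and> bounded_by C W"
    if "x \<in> K" for x
  proof -
    have "x \<in> S" using that assms(3) by blast
    then obtain W F where W: "open W" "x \<in> W" "\<And>v. continuous_on W (F v)"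
      "\<And>x. x \<in> W \<inter> interior S \<Longrightarrow> (f has_derivative (\<lambda>v. F v x)) (at x)"
      by (rule C1_on_local_partials[OF assms(1)]) blast
    have F: "frechet_derivative f (at y) v = F v y" if "y \<in> W \<inter> interior S" for y
      using frechet_derivative_at[OF W(4)[OF that]] by metis
    let ?V = "W \<inter> F v -` ball (F v x) 1"
    have "open ?V"
      using W(3)[of v] continuous_on_open_vimage[OF W(1), of "F v"] by (simp add: Int_commute)
    moreover have "norm (frechet_derivative f (at y) v) \<le> norm (F v x) + 1" if "y \<in> ?V \<inter> interior S" for y
    proof -
      have "dist (F v x) (F v y) < 1" and "y \<in> W \<inter> interior S" using that by auto
      then show ?thesis using F[of y] norm_triangle_ineq2[of "F v y" "F v x"]
        by (simp add: dist_norm norm_minus_commute)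
    qed
    ultimately show ?thesis
      using W(2) by (intro exI[of _ ?V] exI[of _ "norm (F v x) + 1"] conjI)
        (auto simp: bounded_by_def)
  qed
  then obtain W C where W: "\<And>x. x \<in> K \<Longrightarrow> open (W x) \<and> x \<in> W x \<and> bounded_by (C x) (W x)"
    by metis
  have "\<And>x. x \<in> K \<Longrightarrow> open (W x)" and "K \<subseteq> (\<Union>x\<in>K. W x)"
    using W by auto
  then obtain D where D: "D \<subseteq> K" "finite D" "K \<subseteq> (\<Union>x\<in>D. W x)"
    by (rule compactE_image[OF assms(2)])
  have "norm (frechet_derivative f (at y) v) \<le> (\<Sum>x\<in>D. \<bar>C x\<bar>)" if y: "y \<in> K \<inter> interior S" for y
  proof -
    obtain x where x: "x \<in> D" "y \<in> W x" using D(3) y by blast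
    then have "norm (frechet_derivative f (at y) v) \<le> \<bar>C x\<bar>"
      using W[of x] D(1) y unfolding bounded_by_def by (meson IntD2 IntI abs_ge_self order_trans subsetD)
    also have "\<dots> \<le> (\<Sum>x\<in>D. \<bar>C x\<bar>)"
      using x(1) D(2) by (intro member_le_sum) auto
    finally show ?thesis .
  qed
  then show ?thesis by blast
qed

section \<open>The Cahn-Hoffman map\<close>

text \<open>On the sphere the height function \<open>v \<bullet> y\<close> equals \<open>1 - \<bar>y - v\<bar>\<^sup>2 / 2\<close>, hence is stationary at \<open>v\<close>.  So the
  normal component of a gradient can be removed without affecting the derivative within the sphere.\<close>
lemma sphere_inner_has_derivative_0:
  fixes v :: "'a::real_inner"
  assumes "norm v = 1"
  shows "((\<lambda>y. v \<bullet> y) has_derivative (\<lambda>h. 0)) (at v within sphere 0 1)"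
proof (rule has_derivative_transform)
  show "((\<lambda>y. 1 - ((y - v) \<bullet> (y - v)) / 2) has_derivative (\<lambda>h. 0)) (at v within sphere 0 1)"
    by (auto intro!: derivative_eq_intros)
  fix y :: 'a assume "y \<in> sphere 0 1"
  then have "y \<bullet> y = 1" by (simp add: norm_eq_1)
  then show "v \<bullet> y = 1 - ((y - v) \<bullet> (y - v)) / 2"
    using assms by (simp add: norm_eq_1 inner_diff_left inner_diff_right inner_commute diff_divide_distrib)
qed (use assms in auto)

text \<open>A tangential gradient is determined by the derivative within the sphere: test it along the great
  circle through \<open>v\<close> in its own direction.\<close>
lemma sphere_derivative_0_imp_eq_0:
  fixes v :: "'a::real_inner"
  assumes v: "norm v = 1" and d: "d \<bullet> v = 0"
    and der: "((\<lambda>_. 0 :: real) has_derivative (\<lambda>h. d \<bullet> h)) (at v within sphere 0 1)"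
  shows "d = 0"
proof (rule ccontr)
  assume "d \<noteq> 0"
  define u where "u = d /\<^sub>R norm d"
  have u: "u \<bullet> u = 1" "v \<bullet> u = 0"
    using \<open>d \<noteq> 0\<close> d by (auto simp: u_def inner_commute dot_square_norm power2_eq_square)
  define c where "c = (\<lambda>s::real. cos s *\<^sub>R v + sin s *\<^sub>R u)"
  have "c ` UNIV \<subseteq> sphere 0 1"
    using u v by (auto simp: c_def norm_eq_1 inner_add_left inner_add_right inner_commute[of u v]
        power2_eq_square[symmetric])
  moreover have c0: "c 0 = v" by (simp add: c_def)
  ultimately have "((\<lambda>_. 0 :: real) has_derivative (\<lambda>h. d \<bullet> h)) (at (c 0) within c ` UNIV)"
    using der by (auto intro: has_derivative_subset)
  moreover have "(c has_derivative (\<lambda>s. s *\<^sub>R u)) (at 0)"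
    unfolding c_def by (auto intro!: derivative_eq_intros)
  ultimately have "((\<lambda>_. 0 :: real) has_derivative (\<lambda>s. d \<bullet> (s *\<^sub>R u))) (at 0)"
    using has_derivative_in_compose[of c "\<lambda>s. s *\<^sub>R u" 0 UNIV "\<lambda>_. 0 :: real" "\<lambda>h. d \<bullet> h"] by simp
  then have "(\<lambda>s. d \<bullet> (s *\<^sub>R u)) = (\<lambda>_. 0)"
    by (rule has_derivative_unique) simp
  then have "d \<bullet> (1 *\<^sub>R u) = 0" by metis
  then show False using \<open>d \<noteq> 0\<close> by (simp add: u_def)
qed

lemma sphere_grad_eq:
  assumes v: "norm v = 1"
    and der: "(\<gamma> has_derivative (\<lambda>h. a \<bullet> h)) (at v within sphere 0 1)"
  shows "sphere_grad \<gamma> v = a - (a \<bullet> v) *\<^sub>R v"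
    and "(\<gamma> has_derivative (\<lambda>h. sphere_grad \<gamma> v \<bullet> h)) (at v within sphere 0 1)"
proof -
  let ?g = "a - (a \<bullet> v) *\<^sub>R v"
  have "((\<lambda>y. \<gamma> y - (a \<bullet> v) * (v \<bullet> y) + (a \<bullet> v) * (v \<bullet> y)) has_derivative
      (\<lambda>h. a \<bullet> h - (a \<bullet> v) * (v \<bullet> h) + (a \<bullet> v) * 0)) (at v within sphere 0 1)"
    by (intro has_derivative_add has_derivative_diff der has_derivative_mult_right
        sphere_inner_has_derivative_0[OF v] has_derivative_inner_right has_derivative_ident)
  then have g: "(\<gamma> has_derivative (\<lambda>h. ?g \<bullet> h)) (at v within sphere 0 1)"
    by (simp add: inner_diff_left)
  have g0: "?g \<bullet> v = 0" using v by (simp add: inner_diff_left norm_eq_1)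
  show eq: "sphere_grad \<gamma> v = ?g"
    unfolding sphere_grad_def
  proof (rule the_equality)
    fix b assume b: "b \<bullet> v = 0 \<and> (\<gamma> has_derivative (\<lambda>h. b \<bullet> h)) (at v within sphere 0 1)"
    then have "((\<lambda>y. \<gamma> y - \<gamma> y) has_derivative (\<lambda>h. b \<bullet> h - ?g \<bullet> h)) (at v within sphere 0 1)"
      using g by (intro has_derivative_diff) auto
    then have "((\<lambda>_. 0 :: real) has_derivative (\<lambda>h. (b - ?g) \<bullet> h)) (at v within sphere 0 1)"
      by (simp add: inner_diff_left)
    then have "b - ?g = 0"
      using b g0 by (intro sphere_derivative_0_imp_eq_0[OF v]) (auto simp: inner_diff_left)
    then show "b = ?g" by simp
  qed (use g g0 in simp)
  show "(\<gamma> has_derivative (\<lambda>h. sphere_grad \<gamma> v \<bullet> h)) (at v within sphere 0 1)"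
    unfolding eq by (rule g)
qed

text \<open>The spherical gradient is the tangential part of the gradient \<open>a\<close> of any local extension \<open>g\<close>.\<close>
lemma sphere_grad_works:
  assumes v: "norm v = 1" and "open W" "v \<in> W" "g differentiable (at v)"
    and eq: "\<And>y. y \<in> sphere 0 1 \<inter> W \<Longrightarrow> g y = \<gamma> y"
  defines "a \<equiv> (\<Sum>b\<in>Basis. frechet_derivative g (at v) b *\<^sub>R b)"
  shows "sphere_grad \<gamma> v = a - (a \<bullet> v) *\<^sub>R v"
    and "sphere_grad \<gamma> v \<bullet> v = 0"
    and "(\<gamma> has_derivative (\<lambda>h. sphere_grad \<gamma> v \<bullet> h)) (at v within sphere 0 1)"
proof -
  let ?g' = "frechet_derivative g (at v)"
  have g': "(g has_derivative ?g') (at v)"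
    using assms(4) frechet_derivative_works by blast
  then have lin: "linear ?g'" by (rule has_derivative_linear)
  have a: "?g' h = a \<bullet> h" for h
  proof -
    have "?g' h = ?g' (\<Sum>b\<in>Basis. (h \<bullet> b) *\<^sub>R b)" by (simp add: euclidean_representation)
    also have "\<dots> = (\<Sum>b\<in>Basis. (h \<bullet> b) * ?g' b)"
      using lin by (simp add: linear_sum linear_cmul)
    finally show ?thesis by (simp add: a_def inner_sum_left inner_commute[of h] mult.commute)
  qed
  obtain d where d: "d > 0" "ball v d \<subseteq> W"
    using assms(2,3) open_contains_ball by blast
  have "(\<gamma> has_derivative ?g') (at v within sphere 0 1)"
  proof (rule has_derivative_transform_within[OF _ d(1)])
    show "(g has_derivative ?g') (at v within sphere 0 1)"
      using g' by (rule has_derivative_at_withinI)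
    show "g y = \<gamma> y" if "y \<in> sphere 0 1" "dist y v < d" for y
      using that d(2) by (intro eq) (auto simp: dist_commute)
  qed (use v in simp)
  moreover have "?g' = (\<lambda>h. a \<bullet> h)" using a by auto
  ultimately have der: "(\<gamma> has_derivative (\<lambda>h. a \<bullet> h)) (at v within sphere 0 1)"
    by (simp only:)
  show eqn: "sphere_grad \<gamma> v = a - (a \<bullet> v) *\<^sub>R v" by (rule sphere_grad_eq(1)[OF v der])
  show "sphere_grad \<gamma> v \<bullet> v = 0"
    using v by (simp add: eqn inner_diff_left norm_eq_1)
  show "(\<gamma> has_derivative (\<lambda>h. sphere_grad \<gamma> v \<bullet> h)) (at v within sphere 0 1)"
    by (rule sphere_grad_eq(2)[OF v der])
qed

text \<open>Near \<open>v\<close> the map is given by the formula \<open>\<nabla>g - (\<nabla>g \<bullet> x) x + g x\<close> in a local \<open>C\<^sup>2\<close> extension \<open>g\<close>; one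
  derivative is lost to the gradient.\<close>
lemma cahn_hoffman_C1:
  fixes \<gamma> :: "'a::euclidean_space \<Rightarrow> real"
  assumes "Ck_on 2 (sphere 0 1) \<gamma>"
  shows "Ck_on 1 (sphere 0 1) (cahn_hoffman \<gamma>)"
  unfolding Ck_on_def
proof
  fix v :: 'a assume v: "v \<in> sphere 0 1"
  obtain W g where W: "open W" "v \<in> W" "Ck_open 2 W g" "\<forall>y\<in>sphere 0 1 \<inter> W. g y = \<gamma> y"
    using assms v unfolding Ck_on_def by blast
  have g2: "Ck_open (Suc (Suc 0)) W g" using W(3) by (simp add: numeral_2_eq_2)
  have diff: "g differentiable (at x)" if "x \<in> W" for x
    using g2 that by (simp add: Ck_open.simps)
  have g1: "Ck_open 1 W g"
    using Ck_open_SucD[OF g2] by simp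
  have dg: "Ck_open 1 W (\<lambda>x. frechet_derivative g (at x) b)" for b
    using g2 by (simp add: Ck_open.simps)
  let ?a = "\<lambda>x. \<Sum>b\<in>Basis. frechet_derivative g (at x) b *\<^sub>R b"
  let ?G = "\<lambda>x. ?a x + ((- 1) *\<^sub>R (?a x \<bullet> x)) *\<^sub>R x + g x *\<^sub>R x"
  have a: "Ck_open 1 W ?a"
    by (intro C1_open_sum bounded_bilinear.C1_open[OF bounded_bilinear_scaleR] dg C1_open_const)
  have "Ck_open 1 W ?G"
    by (intro C1_open_add a g1 bounded_bilinear.C1_open[OF bounded_bilinear_scaleR]
        bounded_bilinear.C1_open[OF bounded_bilinear_inner] C1_open_const C1_open_ident)
  moreover have "?G y = cahn_hoffman \<gamma> y" if y: "y \<in> sphere 0 1 \<inter> W" for y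
  proof -
    have "sphere_grad \<gamma> y = ?a y - (?a y \<bullet> y) *\<^sub>R y"
      using y W(4) diff by (intro sphere_grad_works(1)[of y W g \<gamma>]) (auto intro: W(1))
    moreover have "g y = \<gamma> y" using W(4) y by blast
    ultimately show ?thesis by (simp only: cahn_hoffman_def) simp
  qed
  ultimately show "\<exists>W h. open W \<and> v \<in> W \<and> Ck_open 1 W h \<and>
      (\<forall>y\<in>sphere 0 1 \<inter> W. h y = cahn_hoffman \<gamma> y)"
    using W(1,2) by (intro exI[of _ W] exI[of _ ?G]) auto
qed

text \<open>Write \<open>\<xi>\<close> for the Cahn-Hoffman map.  Differentiating \<open>\<xi> N \<bullet> N = \<gamma> N\<close> gives \<open>d(\<xi> N) \<bullet> N + \<xi> N \<bullet> dN = d(\<gamma> N)\<close>.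
  As \<open>dN\<close> is orthogonal to \<open>N\<close>, only the gradient part of \<open>\<xi> N\<close> enters the second term, which is therefore
  \<open>d(\<gamma> N)\<close> itself, and the first term vanishes.\<close>
lemma cahn_hoffman_derivative_tangent:
  fixes N :: "'b::real_normed_vector \<Rightarrow> 'a::euclidean_space"
  assumes \<gamma>: "Ck_on 1 (sphere 0 1) \<gamma>"
    and U: "open U" "x \<in> U" "\<And>y. y \<in> U \<Longrightarrow> norm (N y) = 1"
    and N': "(N has_derivative N') (at x)"
    and Z: "((\<lambda>y. cahn_hoffman \<gamma> (N y)) has_derivative Z) (at x)"
  shows "N x \<bullet> Z h = 0"
proof -
  have nx: "norm (N x) = 1" using U by simp
  have ext: "\<exists>W g. open W \<and> v \<in> W \<and> g differentiable (at v) \<and> (\<forall>y\<in>sphere 0 1 \<inter> W. g y = \<gamma> y)"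
    if "norm v = 1" for v
  proof -
    have "v \<in> sphere 0 1" using that by simp
    then obtain W g where "open W" "v \<in> W" "Ck_open 1 W g" "\<forall>y\<in>sphere 0 1 \<inter> W. g y = \<gamma> y"
      using \<gamma> unfolding Ck_on_def by blast
    then show ?thesis by (intro exI[of _ W] exI[of _ g]) (auto simp: Ck_open.simps)
  qed
  have orth: "sphere_grad \<gamma> v \<bullet> v = 0" if v1: "norm v = 1" for v
  proof -
    obtain W g where "open W" "v \<in> W" "g differentiable (at v)" "\<forall>y\<in>sphere 0 1 \<inter> W. g y = \<gamma> y"
      using ext[OF v1] by blast
    then show ?thesis by (intro sphere_grad_works(2)[of v W g \<gamma>, OF v1]) auto
  qed
  have der: "(\<gamma> has_derivative (\<lambda>h. sphere_grad \<gamma> v \<bullet> h)) (at v within sphere 0 1)" if v1: "norm v = 1" for v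
  proof -
    obtain W g where "open W" "v \<in> W" "g differentiable (at v)" "\<forall>y\<in>sphere 0 1 \<inter> W. g y = \<gamma> y"
      using ext[OF v1] by blast
    then show ?thesis by (intro sphere_grad_works(3)[of v W g \<gamma>, OF v1]) auto
  qed
  have NN: "N x \<bullet> N' h = 0"
  proof -
    have "((\<lambda>y. N y \<bullet> N y) has_derivative (\<lambda>h. N x \<bullet> N' h + N' h \<bullet> N x)) (at x)"
      by (intro has_derivative_inner N')
    moreover have "((\<lambda>y. N y \<bullet> N y) has_derivative (\<lambda>h. 0)) (at x)"
      by (rule has_derivative_transform_within_open[of "\<lambda>_. 1" _ _ _ U])
        (use U in \<open>auto simp: norm_eq_1\<close>)
    ultimately have "(\<lambda>h. N x \<bullet> N' h + N' h \<bullet> N x) = (\<lambda>h. 0)"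
      by (rule has_derivative_unique)
    from fun_cong[OF this, of h] show ?thesis by (simp add: inner_commute)
  qed
  have "((\<lambda>y. \<gamma> (N y)) has_derivative (\<lambda>h. sphere_grad \<gamma> (N x) \<bullet> N' h)) (at x within U)"
  proof (rule has_derivative_in_compose[of N N' x U \<gamma> "\<lambda>h. sphere_grad \<gamma> (N x) \<bullet> h"])
    show "(N has_derivative N') (at x within U)" using N' by (rule has_derivative_at_withinI)
    show "(\<gamma> has_derivative (\<lambda>h. sphere_grad \<gamma> (N x) \<bullet> h)) (at (N x) within N ` U)"
      using der[OF nx] U(3) by (auto intro: has_derivative_subset)
  qed
  then have gN: "((\<lambda>y. \<gamma> (N y)) has_derivative (\<lambda>h. sphere_grad \<gamma> (N x) \<bullet> N' h)) (at x)"
    by (simp only: at_within_open[OF U(2,1)])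
  have "((\<lambda>y. cahn_hoffman \<gamma> (N y) \<bullet> N y) has_derivative
      (\<lambda>h. cahn_hoffman \<gamma> (N x) \<bullet> N' h + Z h \<bullet> N x)) (at x)"
    by (intro has_derivative_inner N' Z)
  then have "((\<lambda>y. \<gamma> (N y)) has_derivative
      (\<lambda>h. cahn_hoffman \<gamma> (N x) \<bullet> N' h + Z h \<bullet> N x)) (at x)"
    by (rule has_derivative_transform_within_open[OF _ U(1,2)])
      (use U(3) in \<open>simp add: cahn_hoffman_def inner_add_left orth norm_eq_1\<close>)
  from fun_cong[OF has_derivative_unique[OF gN this], of h] show ?thesis
    using NN by (simp add: cahn_hoffman_def inner_add_left inner_commute[of "Z h"])
qed

section \<open>The volume form of a parallel hypersurface\<close>

lemma chart_inv_image_eq: "is_chart c \<Longrightarrow> p \<in> fst c \<Longrightarrow> chart_inv c (snd c p) = p"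
  by (auto simp: is_chart_def homeomorphism_def)

lemma chart_inv_in_domain: "is_chart c \<Longrightarrow> x \<in> snd c ` fst c \<Longrightarrow> chart_inv c x \<in> fst c"
  by (auto simp: chart_inv_image_eq)

lemma chart_image_vimage:
  assumes "is_chart c"
  shows "snd c ` (fst c \<inter> U) = snd c ` fst c \<inter> chart_inv c -` U"
  using assms by (auto simp: chart_inv_image_eq)

lemma chart_image_open:
  assumes c: "is_chart c" and U: "open U"
  shows "open (snd c ` (fst c \<inter> U))"
proof -
  have "continuous_on (snd c ` fst c) (chart_inv c)" and "open (snd c ` fst c)"
    using c by (auto simp: is_chart_def homeomorphism_def)
  then show ?thesis
    unfolding chart_image_vimage[OF c] using U continuous_on_open_vimage by (metis Int_commute)
qed

lemma chart_image_interior: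
  assumes c: "is_chart c"
  shows "snd c ` (fst c \<inter> interior S) \<subseteq> interior (snd c ` (fst c \<inter> S))"
  using interior_subset by (intro interior_maximal chart_image_open c open_interior) blast

lemma chart_eq_near:
  assumes c: "is_chart c" and U: "open U" "p \<in> U" "p \<in> fst c"
    and eq: "\<And>q. q \<in> U \<Longrightarrow> f q = g q"
  shows "((f \<circ> chart_inv c) has_derivative F) (at (snd c p)) \<longleftrightarrow>
    ((g \<circ> chart_inv c) has_derivative F) (at (snd c p))"
proof -
  have "open (snd c ` (fst c \<inter> U))" "snd c p \<in> snd c ` (fst c \<inter> U)"
    using chart_image_open[OF c U(1)] U by auto
  then show ?thesis
    using eq by (auto simp: chart_inv_image_eq[OF c] elim!: has_derivative_transform_within_open)
qed

lemma chart_deriv_cong: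
  assumes "is_chart c" "open U" "p \<in> U" "p \<in> fst c" "\<And>q. q \<in> U \<Longrightarrow> f q = g q"
  shows "chart_deriv c f p = chart_deriv c g p"
  using chart_eq_near[OF assms] by (simp add: chart_deriv_def frechet_derivative_def)

lemma atlasD:
  assumes "oriented_smooth_atlas A"
  shows "c \<in> A \<Longrightarrow> is_chart c" and "\<exists>c\<in>A. p \<in> fst c"
  using assms by (auto simp: oriented_smooth_atlas_def)

lemma transition_differentiable:
  assumes "smooth_transition c d" "p \<in> fst c" "p \<in> fst d"
  shows "(snd d \<circ> chart_inv c) differentiable (at (snd c p))"
proof -
  have "Ck_open (Suc 0) (snd c ` (fst c \<inter> fst d)) (snd d \<circ> chart_inv c)"
    using assms(1) by (simp only: smooth_transition_def)
  then show ?thesis using assms(2,3) by (auto simp: Ck_open.simps)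
qed

definition jacobian :: "('m, 'n::finite) chart \<Rightarrow> ('m, 'n) chart \<Rightarrow> 'm \<Rightarrow> real ^ 'n ^ 'n" where
  "jacobian c d p = matrix (frechet_derivative (snd d \<circ> chart_inv c) (at (snd c p)))"

lemma chart_partial_change:
  assumes A: "oriented_smooth_atlas A" and cd: "c \<in> A" "d \<in> A" and p: "p \<in> fst c" "p \<in> fst d"
    and f: "(f \<circ> chart_inv d) differentiable (at (snd d p))"
  shows "chart_partial c j f p = (\<Sum>i\<in>UNIV. jacobian c d p $ i $ j *\<^sub>R chart_partial d i f p)"
proof -
  have c: "is_chart c" and d: "is_chart d" using atlasD(1)[OF A] cd by auto
  have st: "smooth_transition c d" using A cd by (simp add: oriented_smooth_atlas_def)
  let ?T = "snd d \<circ> chart_inv c"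
  let ?T' = "frechet_derivative ?T (at (snd c p))"
  let ?F = "frechet_derivative (f \<circ> chart_inv d) (at (snd d p))"
  have T: "(?T has_derivative ?T') (at (snd c p))"
    using transition_differentiable[OF st p] by (simp add: frechet_derivative_works)
  have F: "((f \<circ> chart_inv d) has_derivative ?F) (at (?T (snd c p)))"
    using f by (simp add: frechet_derivative_works chart_inv_image_eq[OF c p(1)])
  have "(((f \<circ> chart_inv d) \<circ> ?T) has_derivative (?F \<circ> ?T')) (at (snd c p))"
    by (rule diff_chain_at[OF T F])
  then have "((f \<circ> chart_inv c) has_derivative (?F \<circ> ?T')) (at (snd c p))"
  proof (rule has_derivative_transform_within_open)
    show "open (snd c ` (fst c \<inter> fst d))"
      using chart_image_open[OF c] d by (simp add: is_chart_def)
    show "((f \<circ> chart_inv d) \<circ> ?T) x = (f \<circ> chart_inv c) x" if "x \<in> snd c ` (fst c \<inter> fst d)" for x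
      using that chart_inv_image_eq[OF c] chart_inv_image_eq[OF d] by auto
  qed (use p in auto)
  then have "chart_partial c j f p = ?F (?T' (axis j 1))"
    by (simp add: chart_partial_def chart_deriv_def frechet_derivative_at[symmetric])
  also have "?T' (axis j 1) = (\<Sum>i\<in>UNIV. jacobian c d p $ i $ j *\<^sub>R axis i 1)"
    by (simp add: jacobian_def matrix_def vec_eq_iff axis_def if_distrib cong: if_cong)
  also have "?F \<dots> = (\<Sum>i\<in>UNIV. jacobian c d p $ i $ j *\<^sub>R ?F (axis i 1))"
    using has_derivative_linear[OF F] by (simp add: linear_sum linear_cmul)
  finally show ?thesis by (simp add: chart_partial_def chart_deriv_def)
qed

text \<open>The factor is the same for every map \<open>f\<close>, so quotients of two such coefficients do not depend on the
  chart.\<close>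
lemma vol_form_change:
  assumes A: "oriented_smooth_atlas A" and cd: "c \<in> A" "d \<in> A" and p: "p \<in> fst c" "p \<in> fst d"
    and f: "(f \<circ> chart_inv d) differentiable (at (snd d p))"
  shows "vol_form \<nu> f c p = det (jacobian c d p) * vol_form \<nu> f d p"
  unfolding vol_form_def chart_partial_change[OF assms] frame_det_linear ..

lemma unit_normal_eqI:
  assumes A: "oriented_smooth_atlas A" and v: "is_unit_normal A X p v"
  shows "unit_normal A X p = v"
  unfolding unit_normal_def
proof (rule the_equality[where P = "is_unit_normal A X p", OF v])
  fix v' assume v': "is_unit_normal A X p v'"
  obtain c where "c \<in> A" "p \<in> fst c" using atlasD(2)[OF A] by blast
  then show "v' = v"
    using v v' by (intro normal_to_frame_unique[of v "\<lambda>j. chart_partial c j X p"])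
      (auto simp: is_unit_normal_def)
qed

text \<open>The situation at an interior point of a piece.  Both \<open>X\<close> and its Cahn-Hoffman
  field are differentiable there, and the derivative of the field is tangent to the hypersurface.\<close>
locale aniso_regular_point =
  fixes A :: "('m::topological_space, 'n::finite) chart set"
    and \<gamma> :: "real ^ 'n option \<Rightarrow> real" and X :: "'m \<Rightarrow> real ^ 'n option" and p :: 'm
  assumes atlas: "oriented_smooth_atlas A"
    and differentiable_X: "\<And>c. c \<in> A \<Longrightarrow> p \<in> fst c \<Longrightarrow> (X \<circ> chart_inv c) differentiable (at (snd c p))"
    and differentiable_field: "\<And>c. c \<in> A \<Longrightarrow> p \<in> fst c \<Longrightarrow>
      (cahn_hoffman_field A \<gamma> X \<circ> chart_inv c) differentiable (at (snd c p))"
    and normal: "is_unit_normal A X p (unit_normal A X p)"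
    and tangent: "\<And>c j. c \<in> A \<Longrightarrow> p \<in> fst c \<Longrightarrow>
      unit_normal A X p \<bullet> chart_partial c j (cahn_hoffman_field A \<gamma> X) p = 0"
begin

lemma shape_matrix:
  assumes c: "c \<in> A" "p \<in> fst c"
  shows "(\<Sum>i\<in>UNIV. aniso_shape_matrix A \<gamma> X c p $ i $ j *\<^sub>R chart_partial c i X p) =
    - chart_partial c j (cahn_hoffman_field A \<gamma> X) p"
proof -
  have "\<exists>!S :: real ^ 'n ^ 'n. \<forall>j. (\<Sum>i\<in>UNIV. S $ i $ j *\<^sub>R chart_partial c i X p) =
      - chart_partial c j (cahn_hoffman_field A \<gamma> X) p"
    by (rule tangent_endomorphism_matrix[where v = "unit_normal A X p"])
      (use normal c tangent[OF c] in \<open>auto simp: is_unit_normal_def\<close>)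
  from theI'[OF this] show ?thesis unfolding aniso_shape_matrix_def by blast
qed

lemma differentiable_parallel:
  assumes c: "c \<in> A" "p \<in> fst c"
  shows "(aniso_parallel A \<gamma> X t \<circ> chart_inv c) differentiable (at (snd c p))"
    and "chart_partial c j (aniso_parallel A \<gamma> X t) p =
      chart_partial c j X p + t *\<^sub>R chart_partial c j (cahn_hoffman_field A \<gamma> X) p"
proof -
  let ?x = "snd c p" and ?\<xi> = "cahn_hoffman_field A \<gamma> X"
  have "(X \<circ> chart_inv c has_derivative frechet_derivative (X \<circ> chart_inv c) (at ?x)) (at ?x)"
    and "(?\<xi> \<circ> chart_inv c has_derivative frechet_derivative (?\<xi> \<circ> chart_inv c) (at ?x)) (at ?x)"
    using differentiable_X[OF c] differentiable_field[OF c] by (simp_all add: frechet_derivative_works)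
  then have "((\<lambda>x. (X \<circ> chart_inv c) x + t *\<^sub>R (?\<xi> \<circ> chart_inv c) x) has_derivative
      (\<lambda>h. chart_deriv c X p h + t *\<^sub>R chart_deriv c ?\<xi> p h)) (at ?x)"
    unfolding chart_deriv_def by (intro has_derivative_add has_derivative_scaleR_right)
  moreover have "(\<lambda>x. (X \<circ> chart_inv c) x + t *\<^sub>R (?\<xi> \<circ> chart_inv c) x) = aniso_parallel A \<gamma> X t \<circ> chart_inv c"
    by (auto simp: aniso_parallel_def)
  ultimately have D: "(aniso_parallel A \<gamma> X t \<circ> chart_inv c has_derivative
      (\<lambda>h. chart_deriv c X p h + t *\<^sub>R chart_deriv c ?\<xi> p h)) (at ?x)" by simp
  show "(aniso_parallel A \<gamma> X t \<circ> chart_inv c) differentiable (at ?x)"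
    using D unfolding differentiable_def by blast
  show "chart_partial c j (aniso_parallel A \<gamma> X t) p =
      chart_partial c j X p + t *\<^sub>R chart_partial c j ?\<xi> p"
    unfolding chart_partial_def chart_deriv_def[of c "aniso_parallel A \<gamma> X t"]
      frechet_derivative_at[OF D, symmetric] ..
qed

text \<open>The tangent frame of the parallel hypersurface is that of \<open>X\<close> transformed by \<open>1 - t S\<close>.\<close>
lemma vol_form_parallel:
  assumes c: "c \<in> A" "p \<in> fst c"
  shows "vol_form \<nu> (aniso_parallel A \<gamma> X t) c p =
    det (mat 1 - t *\<^sub>R aniso_shape_matrix A \<gamma> X c p) * vol_form \<nu> X c p"
proof -
  let ?S = "aniso_shape_matrix A \<gamma> X c p"
  have "chart_partial c j (aniso_parallel A \<gamma> X t) p =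
      (\<Sum>i\<in>UNIV. (mat 1 - t *\<^sub>R ?S) $ i $ j *\<^sub>R chart_partial c i X p)" for j
  proof -
    have "(\<Sum>i\<in>UNIV. (mat 1 - t *\<^sub>R ?S) $ i $ j *\<^sub>R chart_partial c i X p) =
        (\<Sum>i\<in>UNIV. (if i = j then chart_partial c i X p else 0)
          - t *\<^sub>R (?S $ i $ j *\<^sub>R chart_partial c i X p))"
      by (intro sum.cong) (auto simp: mat_def algebra_simps)
    also have "\<dots> = chart_partial c j X p - t *\<^sub>R (\<Sum>i\<in>UNIV. ?S $ i $ j *\<^sub>R chart_partial c i X p)"
      by (simp add: sum_subtractf scaleR_right.sum)
    finally show ?thesis
      unfolding shape_matrix[OF c] differentiable_parallel(2)[OF c] by simp
  qed
  then show ?thesis unfolding vol_form_def by (simp only: frame_det_linear)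
qed

text \<open>The curvatures are eigenvalues of the shape matrix in some chart \<open>d\<close>, possibly different from \<open>c\<close>.
  Instead of conjugating shape matrices, the claim is proved in \<open>d\<close> and both volume forms are then
  transformed to \<open>c\<close> by the same Jacobian.\<close>
lemma vol_form_parallel_curvatures:
  assumes c: "c \<in> A" "p \<in> fst c"
  shows "(\<Prod>l=1..CARD('n). 1 - complex_of_real t * aniso_curvature A \<gamma> X l p) *
      complex_of_real (vol_form \<nu> X c p) =
    complex_of_real (vol_form \<nu> (aniso_parallel A \<gamma> X t) c p)"
proof -
  let ?ks = "aniso_curvatures A \<gamma> X p"
  have "\<exists>ks. \<exists>d\<in>A. p \<in> fst d \<and> mset ks = proots (complex_charpoly (aniso_shape_matrix A \<gamma> X d p))"
    using c ex_mset by metis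
  then have "\<exists>d\<in>A. p \<in> fst d \<and> mset ?ks = proots (complex_charpoly (aniso_shape_matrix A \<gamma> X d p))"
    unfolding aniso_curvatures_def by (rule someI_ex)
  then obtain d where d: "d \<in> A" "p \<in> fst d"
    and ks: "mset ?ks = proots (complex_charpoly (aniso_shape_matrix A \<gamma> X d p))" by blast
  have "vol_form \<nu> (aniso_parallel A \<gamma> X t) c p =
      det (jacobian c d p) * vol_form \<nu> (aniso_parallel A \<gamma> X t) d p"
    by (rule vol_form_change[OF atlas c(1) d(1) c(2) d(2) differentiable_parallel(1)[OF d]])
  moreover have "vol_form \<nu> X c p = det (jacobian c d p) * vol_form \<nu> X d p"
    by (rule vol_form_change[OF atlas c(1) d(1) c(2) d(2) differentiable_X[OF d]])
  ultimately have "vol_form \<nu> (aniso_parallel A \<gamma> X t) c p =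
      det (mat 1 - t *\<^sub>R aniso_shape_matrix A \<gamma> X d p) * vol_form \<nu> X c p"
    by (simp add: vol_form_parallel[OF d])
  then show ?thesis
    unfolding aniso_curvature_def prod_one_minus_eigenvalues[OF ks] by simp
qed

end

lemma Cr_on_compose_C1:
  fixes f :: "'m::topological_space \<Rightarrow> 'b::euclidean_space"
  assumes "Cr_on A 1 S f" "Ck_on 1 T g" "f ` S \<subseteq> T" and A: "oriented_smooth_atlas A"
  shows "Cr_on A 1 S (\<lambda>p. g (f p))"
  unfolding Cr_on_def
proof
  fix c assume c: "c \<in> A"
  have "Ck_on 1 (snd c ` (fst c \<inter> S)) (g \<circ> (f \<circ> chart_inv c))"
  proof (rule C1_on_compose)
    show "Ck_on 1 (snd c ` (fst c \<inter> S)) (f \<circ> chart_inv c)"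
      using assms(1) c unfolding Cr_on_def by blast
    show "(f \<circ> chart_inv c) ` snd c ` (fst c \<inter> S) \<subseteq> T"
      using assms(3) chart_inv_image_eq[OF atlasD(1)[OF A c]] by auto
  qed fact
  then show "Ck_on 1 (snd c ` (fst c \<inter> S)) ((\<lambda>p. g (f p)) \<circ> chart_inv c)"
    by (simp add: o_def)
qed

lemma Cr_on_add_C1:
  assumes "Cr_on A 1 S f" "Cr_on A 1 S g"
  shows "Cr_on A 1 S (\<lambda>p. f p + g p)"
  using assms C1_on_add unfolding Cr_on_def o_def by blast

lemma Cr_on_SucD: "Cr_on A (Suc r) S f \<Longrightarrow> Cr_on A r S f"
  unfolding Cr_on_def by (blast intro: Ck_on_SucD)

lemma Cr_on_differentiable:
  assumes A: "oriented_smooth_atlas A" and f: "Cr_on A 1 S f" and c: "c \<in> A"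
    and p: "p \<in> fst c" "p \<in> interior S"
  shows "(f \<circ> chart_inv c) differentiable (at (snd c p))"
proof (rule C1_on_differentiable_interior)
  show "Ck_on 1 (snd c ` (fst c \<inter> S)) (f \<circ> chart_inv c)"
    using f c unfolding Cr_on_def by blast
  show "snd c p \<in> interior (snd c ` (fst c \<inter> S))"
    using chart_image_interior[OF atlasD(1)[OF A c]] p by blast
qed

text \<open>On the interior of \<open>S\<close> the given normal field \<open>N\<close> is the unit normal, so that the Cahn-Hoffman field is
  the composition of two \<open>C\<^sup>1\<close> maps.\<close>
lemma aniso_regular_pointI:
  assumes A: "oriented_smooth_atlas A" and \<gamma>: "Ck_on 2 (sphere 0 1) \<gamma>"
    and X: "Cr_on A 1 S X" and N: "Cr_on A 1 S N" "\<And>p. p \<in> S \<Longrightarrow> norm (N p) = 1"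
    and normal: "\<And>p. p \<in> interior S \<Longrightarrow> is_unit_normal A X p (N p)"
    and p: "p \<in> interior S"
  shows "aniso_regular_point A \<gamma> X p"
proof
  have \<nu>: "unit_normal A X q = N q" if "q \<in> interior S" for q
    using unit_normal_eqI[OF A normal[OF that]] .
  let ?\<xi> = "\<lambda>q. cahn_hoffman \<gamma> (N q)"
  have \<xi>: "Cr_on A 1 S ?\<xi>"
    using N by (intro Cr_on_compose_C1[OF _ cahn_hoffman_C1[OF \<gamma>] _ A]) auto
  have eq: "cahn_hoffman_field A \<gamma> X q = ?\<xi> q" if "q \<in> interior S" for q
    using \<nu>[OF that] by (simp add: cahn_hoffman_field_def)
  show "oriented_smooth_atlas A" by fact
  show "is_unit_normal A X p (unit_normal A X p)"
    using \<nu>[OF p] normal[OF p] by simp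
  fix c assume c: "c \<in> A" "p \<in> fst c"
  note ch = atlasD(1)[OF A c(1)]
  note near = open_interior[of S] p c(2)
  show "(X \<circ> chart_inv c) differentiable (at (snd c p))"
    by (rule Cr_on_differentiable[OF A X c p])
  obtain Z where Z: "((?\<xi> \<circ> chart_inv c) has_derivative Z) (at (snd c p))"
    using Cr_on_differentiable[OF A \<xi> c p] unfolding differentiable_def by blast
  then have Z': "((cahn_hoffman_field A \<gamma> X \<circ> chart_inv c) has_derivative Z) (at (snd c p))"
    using chart_eq_near[OF ch near, of "cahn_hoffman_field A \<gamma> X" ?\<xi>, OF eq] by blast
  then show "(cahn_hoffman_field A \<gamma> X \<circ> chart_inv c) differentiable (at (snd c p))"
    unfolding differentiable_def by blast
  fix j
  obtain N' where N': "((N \<circ> chart_inv c) has_derivative N') (at (snd c p))"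
    using Cr_on_differentiable[OF A N(1) c p] unfolding differentiable_def by blast
  have \<gamma>1: "Ck_on 1 (sphere 0 1) \<gamma>"
    using \<gamma> Ck_on_SucD[of 1 _ \<gamma>] by (simp add: numeral_2_eq_2)
  have "(N \<circ> chart_inv c) (snd c p) \<bullet> Z (axis j 1) = 0"
  proof (rule cahn_hoffman_derivative_tangent[OF \<gamma>1, where N = "N \<circ> chart_inv c" and x = "snd c p"
        and U = "snd c ` (fst c \<inter> interior S)"])
    show "open (snd c ` (fst c \<inter> interior S))" by (rule chart_image_open[OF ch open_interior])
    show "snd c p \<in> snd c ` (fst c \<inter> interior S)" using p c by blast
    show "norm ((N \<circ> chart_inv c) y) = 1" if "y \<in> snd c ` (fst c \<inter> interior S)" for y
      using that N(2) interior_subset[of S] chart_inv_image_eq[OF ch] by (auto dest!: subsetD)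
    show "((\<lambda>y. cahn_hoffman \<gamma> ((N \<circ> chart_inv c) y)) has_derivative Z) (at (snd c p))"
      using Z by (simp add: o_def)
  qed (rule N')
  then show "unit_normal A X p \<bullet> chart_partial c j (cahn_hoffman_field A \<gamma> X) p = 0"
    using \<nu>[OF p] chart_inv_image_eq[OF ch c(2)] frechet_derivative_at[OF Z']
    by (simp add: chart_partial_def chart_deriv_def)
qed

section \<open>Integrability of the energy density\<close>

lemma continuous_on_det:
  fixes M :: "'a::topological_space \<Rightarrow> real ^ 'n ^ 'n"
  assumes "\<And>i j. continuous_on S (\<lambda>x. M x $ i $ j)"
  shows "continuous_on S (\<lambda>x. det (M x))"
  unfolding det_def
  by (intro continuous_on_sum continuous_on_mult continuous_on_const continuous_on_prod assms)

lemma abs_det_le: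
  fixes M :: "real ^ 'n ^ 'n"
  assumes "\<And>i j. \<bar>M $ i $ j\<bar> \<le> C"
  shows "\<bar>det M\<bar> \<le> fact CARD('n) * C ^ CARD('n)"
proof -
  have "\<bar>det M\<bar> \<le> (\<Sum>p | p permutes (UNIV :: 'n set). \<bar>of_int (sign p) * (\<Prod>i\<in>UNIV. M $ i $ p i)\<bar>)"
    unfolding det_def by (rule sum_abs)
  also have "\<dots> \<le> (\<Sum>p | p permutes (UNIV :: 'n set). C ^ CARD('n))"
  proof (rule sum_mono)
    fix p :: "'n \<Rightarrow> 'n"
    have "(\<Prod>i\<in>UNIV. \<bar>M $ i $ p i\<bar>) \<le> (\<Prod>i\<in>(UNIV :: 'n set). C)"
      by (rule prod_mono) (simp add: assms)
    then show "\<bar>of_int (sign p) * (\<Prod>i\<in>UNIV. M $ i $ p i)\<bar> \<le> C ^ CARD('n)"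
      by (simp add: abs_mult abs_prod sign_def)
  qed
  also have "\<dots> = fact CARD('n) * C ^ CARD('n)"
    by (simp add: card_permutations)
  finally show ?thesis .
qed

text \<open>The energy density in a chart: \<open>S\<close> is the image of a piece of the manifold, \<open>f\<close> the hypersurface and
  \<open>n\<close> its normal field in coordinates.\<close>
context
  fixes S :: "(real ^ 'n) set" and f n :: "real ^ 'n \<Rightarrow> real ^ ('n::finite option)"
    and \<gamma> :: "real ^ 'n option \<Rightarrow> real"
  assumes f: "Ck_on 1 S f" and n: "continuous_on S n" and norm_n: "\<And>x. x \<in> S \<Longrightarrow> norm (n x) = 1"
    and \<gamma>: "continuous_on (sphere 0 1) \<gamma>"
begin

lemma energy_density_continuous:
  "continuous_on (interior S)
    (\<lambda>x. \<gamma> (n x) * frame_det (n x) (\<lambda>j. frechet_derivative f (at x) (axis j 1)))"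
proof (rule continuous_on_mult)
  have nS: "continuous_on (interior S) n" using n interior_subset continuous_on_subset by blast
  show "continuous_on (interior S) (\<lambda>x. \<gamma> (n x))"
    by (rule continuous_on_compose2[OF \<gamma> nS]) (use norm_n interior_subset in force)
  show "continuous_on (interior S) (\<lambda>x. frame_det (n x) (\<lambda>j. frechet_derivative f (at x) (axis j 1)))"
    unfolding frame_det_def
  proof (rule continuous_on_det)
    fix a b
    show "continuous_on (interior S) (\<lambda>x. (\<chi> a. case a of None \<Rightarrow> n x
        | Some j \<Rightarrow> frechet_derivative f (at x) (axis j 1)) $ a $ b)"
      by (cases a) (auto intro!: continuous_on_component nS C1_on_partial_continuous[OF f])
  qed
qed

lemma energy_density_bounded:
  assumes K: "compact K" "K \<subseteq> S"
  shows "\<exists>C. \<forall>x\<in>K \<inter> interior S.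
    \<bar>\<gamma> (n x) * frame_det (n x) (\<lambda>j. frechet_derivative f (at x) (axis j 1))\<bar> \<le> C"
proof -
  have "compact (\<gamma> ` sphere 0 1)"
    using \<gamma> compact_sphere by (rule compact_continuous_image)
  then obtain G where G: "\<And>v. norm v = 1 \<Longrightarrow> \<bar>\<gamma> v\<bar> \<le> G"
    using compact_imp_bounded[THEN bounded_iff[THEN iffD1]] by (metis image_eqI mem_sphere_0 real_norm_def)
  have "\<forall>j. \<exists>C. \<forall>x\<in>K \<inter> interior S. norm (frechet_derivative f (at x) (axis j 1)) \<le> C"
    using C1_on_partial_bounded[OF f K] by blast
  then obtain C where C: "\<And>j x. x \<in> K \<inter> interior S \<Longrightarrow>
      norm (frechet_derivative f (at x) (axis j 1)) \<le> C j" by metis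
  define C' where "C' = 1 + (\<Sum>j\<in>UNIV. \<bar>C j\<bar>)"
  let ?D = "fact CARD('n option) * C' ^ CARD('n option) :: real"
  have "\<bar>\<gamma> (n x) * frame_det (n x) (\<lambda>j. frechet_derivative f (at x) (axis j 1))\<bar> \<le> G * ?D"
    if x: "x \<in> K \<inter> interior S" for x
  proof -
    have nx: "norm (n x) = 1" using x K norm_n by auto
    have "norm ((\<chi> a. case a of None \<Rightarrow> n x
        | Some j \<Rightarrow> frechet_derivative f (at x) (axis j 1)) $ a) \<le> C'" for a
    proof (cases a)
      case None
      then show ?thesis using nx by (simp add: C'_def sum_nonneg)
    next
      case (Some j)
      have "\<bar>C j\<bar> \<le> (\<Sum>j\<in>UNIV. \<bar>C j\<bar>)" by (rule member_le_sum) auto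
      then show ?thesis using C[OF x, of j] Some by (simp add: C'_def)
    qed
    then have "\<bar>frame_det (n x) (\<lambda>j. frechet_derivative f (at x) (axis j 1))\<bar> \<le> ?D"
      unfolding frame_det_def by (intro abs_det_le) (meson component_le_norm_cart order_trans)
    then show ?thesis
      using G[OF nx] by (simp only: abs_mult) (intro mult_mono, auto)
  qed
  then show ?thesis by blast
qed

end

lemma set_integrable_continuous_bounded:
  fixes h :: "'a::euclidean_space \<Rightarrow> real"
  assumes "E \<in> sets lebesgue" "bounded E" "continuous_on E h" "\<And>x. x \<in> E \<Longrightarrow> \<bar>h x\<bar> \<le> C"
  shows "set_integrable lebesgue E h"
proof (rule set_integrable_bound)
  have "E \<in> lmeasurable" using assms(1,2) by (simp add: bounded_set_imp_lmeasurable)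
  then have "integrable lebesgue (indicat_real E)"
    by (intro integrable_real_indicator)
      (auto simp: fmeasurable_def top.not_eq_extremum simp del: emeasure_completion)
  then show "set_integrable lebesgue E (\<lambda>_. C)"
    unfolding set_integrable_def by (rule integrable_scaleR_left)
  have "h \<in> borel_measurable (lebesgue_on E)"
    by (rule continuous_imp_measurable_on_sets_lebesgue[OF assms(3,1)])
  then show "set_borel_measurable lebesgue E h"
    using assms(1) unfolding set_borel_measurable_def
    by (subst (asm) borel_measurable_restrict_space_iff) auto
  show "AE x in lebesgue. x \<in> E \<longrightarrow> norm (h x) \<le> norm C"
    using assms(4) by (auto intro!: AE_I2) (meson abs_ge_self order_trans)
qed

lemma set_integrable_continuous_bounded_mult:
  fixes u :: "'a::euclidean_space \<Rightarrow> real" and g :: "'a \<Rightarrow> complex"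
  assumes E: "E \<in> sets lebesgue" and u: "continuous_on E u" "\<And>x. x \<in> E \<Longrightarrow> \<bar>u x\<bar> \<le> C"
    and g: "set_integrable lebesgue E g"
  shows "set_integrable lebesgue E (\<lambda>x. complex_of_real (u x) * g x)"
proof (rule set_integrable_bound)
  show "set_integrable lebesgue E (\<lambda>x. complex_of_real C * g x)" using g by simp
  have "u \<in> borel_measurable (lebesgue_on E)"
    by (rule continuous_imp_measurable_on_sets_lebesgue[OF u(1) E])
  then have "(\<lambda>x. indicat_real E x *\<^sub>R u x) \<in> borel_measurable lebesgue"
    using E by (subst (asm) borel_measurable_restrict_space_iff) auto
  moreover have "(\<lambda>x. indicat_real E x *\<^sub>R g x) \<in> borel_measurable lebesgue"
    using g unfolding set_integrable_def by auto
  ultimately have "(\<lambda>x. complex_of_real (indicat_real E x *\<^sub>R u x) * (indicat_real E x *\<^sub>R g x))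
      \<in> borel_measurable lebesgue" by measurable
  moreover have "(\<lambda>x. complex_of_real (indicat_real E x *\<^sub>R u x) * (indicat_real E x *\<^sub>R g x)) =
      (\<lambda>x. indicat_real E x *\<^sub>R (complex_of_real (u x) * g x))"
    by (auto simp: indicator_def)
  ultimately show "set_borel_measurable lebesgue E (\<lambda>x. complex_of_real (u x) * g x)"
    unfolding set_borel_measurable_def by simp
  show "AE x in lebesgue. x \<in> E \<longrightarrow> norm (complex_of_real (u x) * g x) \<le> norm (complex_of_real C * g x)"
  proof (intro AE_I2 impI)
    fix x assume "x \<in> E"
    then have "\<bar>u x\<bar> \<le> \<bar>C\<bar>" using u(2) by fastforce
    then show "norm (complex_of_real (u x) * g x) \<le> norm (complex_of_real C * g x)"
      by (simp add: norm_mult mult_right_mono)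
  qed
qed

text \<open>Lebesgue measure is complete, so functions supported on a null set are measurable; hence the values of
  the forms on the boundary of a piece, about which nothing is known, do no harm.\<close>
lemma set_integrable_negligible:
  fixes g :: "'a::euclidean_space \<Rightarrow> 'b::{banach, second_countable_topology}"
  assumes "negligible Z"
  shows "set_integrable lebesgue Z g" and "set_lebesgue_integral lebesgue Z g = 0"
proof -
  let ?h = "\<lambda>x. indicat_real Z x *\<^sub>R g x"
  have h: "?h \<in> borel_measurable lebesgue"
  proof (rule measurableI)
    fix T :: "'b set" assume "T \<in> sets borel"
    have neg: "Z \<inter> V \<in> sets lebesgue" for V
      using assms by (intro negligible_imp_sets) (rule negligible_subset, auto)
    have "?h -` T = (if 0 \<in> T then UNIV - (Z \<inter> g -` (- T)) else Z \<inter> g -` T)"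
      using assms by (cases "0 \<in> T") (auto simp: indicator_def of_bool_def split: if_splits)
    then show "?h -` T \<inter> space lebesgue \<in> sets lebesgue"
      using neg[of "g -` (- T)"] neg[of "g -` T"] sets.compl_sets[of "Z \<inter> g -` (- T)" lebesgue]
      by (simp split: if_splits)
  qed simp
  have ae: "AE x in lebesgue. ?h x = 0"
    using assms by (intro AE_I'[of Z]) (auto simp: negligible_iff_null_sets indicator_eq_0_iff)
  have "integrable lebesgue ?h \<longleftrightarrow> integrable lebesgue (\<lambda>_ :: 'a. 0 :: 'b)"
    using h ae by (intro integrable_cong_AE) auto
  then show "set_integrable lebesgue Z g" by (simp add: set_integrable_def)
  have "integral\<^sup>L lebesgue ?h = integral\<^sup>L lebesgue (\<lambda>_ :: 'a. 0 :: 'b)"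
    using h ae by (intro integral_cong_AE) auto
  then show "set_lebesgue_integral lebesgue Z g = 0" by (simp add: set_lebesgue_integral_def)
qed

lemma set_integrable_add_negligible:
  fixes g :: "'a::euclidean_space \<Rightarrow> 'b::{banach, second_countable_topology}"
  assumes g: "set_integrable lebesgue E g" and Z: "negligible Z" and F: "E \<subseteq> F" "F \<subseteq> E \<union> Z"
  shows "set_integrable lebesgue F g"
    and "set_lebesgue_integral lebesgue F g = set_lebesgue_integral lebesgue E g"
proof -
  have Z': "negligible (F - E)" using Z by (rule negligible_subset) (use F in auto)
  note null = set_integrable_negligible[OF Z', of g]
  have eq: "indicat_real F x *\<^sub>R g x = indicat_real E x *\<^sub>R g x + indicat_real (F - E) x *\<^sub>R g x" for x
    using F by (auto simp: indicator_def)
  show "set_integrable lebesgue F g"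
    using g null(1) unfolding set_integrable_def eq by (rule Bochner_Integration.integrable_add)
  show "set_lebesgue_integral lebesgue F g = set_lebesgue_integral lebesgue E g"
    using g null unfolding set_integrable_def set_lebesgue_integral_def eq
    by (subst Bochner_Integration.integral_add) auto
qed

section \<open>Cutting the manifold along charts and pieces\<close>

lemma chart_neighbourhood:
  fixes A :: "('m::t2_space, 'n::finite) chart set"
  assumes A: "oriented_smooth_atlas A"
  shows "\<exists>c\<in>A. \<exists>U. open U \<and> p \<in> U \<and> closure U \<subseteq> fst c"
proof -
  obtain c where c: "c \<in> A" "p \<in> fst c" using atlasD(2)[OF A] by blast
  have ch: "is_chart c" by (rule atlasD(1)[OF A c(1)])
  then have op: "open (fst c)" "open (snd c ` fst c)"
    and cont: "continuous_on (fst c) (snd c)" "continuous_on (snd c ` fst c) (chart_inv c)"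
    by (auto simp: is_chart_def homeomorphism_def)
  obtain e where e: "e > 0" "cball (snd c p) e \<subseteq> snd c ` fst c"
    using op(2) c(2) open_contains_cball by blast
  let ?U = "fst c \<inter> snd c -` ball (snd c p) e" and ?K = "chart_inv c ` cball (snd c p) e"
  have "open ?U"
    using continuous_on_open_vimage[OF op(1), of "snd c"] cont(1) by (simp add: Int_commute)
  moreover have "p \<in> ?U" using c e by simp
  moreover have "closure ?U \<subseteq> ?K"
  proof (rule closure_minimal)
    show "?U \<subseteq> ?K"
      using chart_inv_image_eq[OF ch] by (force simp: image_iff intro: less_imp_le)
    have "compact ?K"
      by (rule compact_continuous_image[OF continuous_on_subset[OF cont(2) e(2)]]) simp
    then show "closed ?K" by (rule compact_imp_closed)
  qed
  moreover have "?K \<subseteq> fst c" using e(2) chart_inv_in_domain[OF ch] by blast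
  ultimately show ?thesis using c(1) by blast
qed

text \<open>Finitely many of the neighbourhoods of the preceding lemma cover the compact manifold.  Removing from
  each of them the union of the earlier ones makes them disjoint.\<close>
lemma is_chart_partition_chart_partition:
  fixes A :: "('m::t2_space, 'n::finite) chart set"
  assumes A: "oriented_smooth_atlas A" and comp: "compact (UNIV :: 'm set)"
  shows "is_chart_partition A (chart_partition A)"
proof -
  have "\<forall>p. \<exists>cU. fst cU \<in> A \<and> open (snd cU) \<and> p \<in> snd cU \<and> closure (snd cU) \<subseteq> fst (fst cU)"
  proof
    fix p
    obtain c U where "c \<in> A" "open U" "p \<in> U" "closure U \<subseteq> fst c"
      using chart_neighbourhood[OF A, of p] by blast
    then show "\<exists>cU. fst cU \<in> A \<and> open (snd cU) \<and> p \<in> snd cU \<and> closure (snd cU) \<subseteq> fst (fst cU)"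
      by (intro exI[of _ "(c, U)"]) simp
  qed
  then obtain cU where cU: "\<And>p. fst (cU p) \<in> A" "\<And>p. open (snd (cU p))" "\<And>p. p \<in> snd (cU p)"
    "\<And>p. closure (snd (cU p)) \<subseteq> fst (fst (cU p))"
    by metis
  obtain F where F: "finite F" "UNIV \<subseteq> (\<Union>p\<in>F. snd (cU p))"
    using compactE_image[OF comp, of UNIV "\<lambda>p. snd (cU p)"] cU(2,3) by (metis UNIV_I UN_I subsetI)
  have "\<exists>\<B>. finite \<B> \<and> (\<forall>(c, B)\<in>\<B>. c \<in> A \<and> B \<in> sets borel \<and> closure B \<subseteq> fst c) \<and>
      (\<Union>(c, B)\<in>\<B>. B) = (\<Union>p\<in>F. snd (cU p)) \<and> pairwise (\<lambda>x y. disjnt (snd x) (snd y)) \<B>"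
    using F(1)
  proof (induction F)
    case empty
    show ?case by (intro exI[of _ "{}"]) auto
  next
    case (insert p F)
    then obtain \<B> where \<B>: "finite \<B>" "\<forall>(c, B)\<in>\<B>. c \<in> A \<and> B \<in> sets borel \<and> closure B \<subseteq> fst c"
      "(\<Union>(c, B)\<in>\<B>. B) = (\<Union>p\<in>F. snd (cU p))" "pairwise (\<lambda>x y. disjnt (snd x) (snd y)) \<B>"
      by blast
    let ?W = "\<Union>p\<in>F. snd (cU p)"
    let ?new = "(fst (cU p), snd (cU p) - ?W)"
    have "closure (snd (cU p) - ?W) \<subseteq> fst (fst (cU p))"
      using cU(4)[of p] closure_mono[of "snd (cU p) - ?W" "snd (cU p)"] by blast
    moreover have "snd (cU p) - ?W \<in> sets borel"
      using cU(2) by (intro sets.Diff borel_open) auto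
    moreover have "pairwise (\<lambda>x y. disjnt (snd x) (snd y)) (insert ?new \<B>)"
    proof -
      have "disjnt B (snd (cU p) - ?W)" if "(c, B) \<in> \<B>" for c B
        using that \<B>(3) unfolding disjnt_def by blast
      then show ?thesis
        using \<B>(4) by (auto simp: pairwise_insert disjnt_sym)
    qed
    moreover have "(\<Union>(c, B)\<in>insert ?new \<B>. B) = (\<Union>p\<in>insert p F. snd (cU p))"
      using \<B>(3) by auto
    ultimately show ?case
      using \<B>(1,2) cU(1) by (intro exI[of _ "insert ?new \<B>"]) auto
  qed
  moreover have "(\<Union>p\<in>F. snd (cU p)) = UNIV" using F(2) by blast
  ultimately have "\<exists>\<B>. is_chart_partition A \<B>"
    unfolding is_chart_partition_def by (simp only:)
  then show ?thesis unfolding chart_partition_def by (rule someI_ex)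
qed

lemma chart_image_borel:
  assumes c: "is_chart c" and B: "B \<in> sets borel"
  shows "snd c ` (fst c \<inter> B) \<in> sets borel"
proof -
  have op: "open (snd c ` fst c)" and cont: "continuous_on (snd c ` fst c) (chart_inv c)"
    using c by (auto simp: is_chart_def homeomorphism_def)
  have "chart_inv c \<in> borel_measurable (restrict_space borel (snd c ` fst c))"
    by (rule borel_measurable_continuous_on_restrict[OF cont])
  from measurable_sets[OF this B] have "snd c ` (fst c \<inter> B) \<in> sets (restrict_space borel (snd c ` fst c))"
    unfolding chart_image_vimage[OF c] by (simp add: space_restrict_space Int_commute)
  then show ?thesis
    using op by (subst (asm) sets_restrict_space_iff) auto
qed

text \<open>The boundary of a piece consists of finitely many subsets of coordinate hyperplanes of other charts.
  The smooth transition to \<open>c\<close> maps them to null sets.\<close>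
lemma frontier_negligible:
  fixes A :: "('m::topological_space, 'n::finite) chart set"
  assumes A: "oriented_smooth_atlas A" and c: "c \<in> A" and R: "piecewise_smooth_region A R"
  shows "negligible (snd c ` (fst c \<inter> frontier R))"
proof -
  obtain \<Q> where \<Q>: "finite \<Q>" "\<forall>Q\<in>\<Q>. hypersurface_piece A Q" "\<Union>\<Q> = frontier R"
    using R unfolding piecewise_smooth_region_def by (elim conjE exE) (rule that)
  have "negligible (snd c ` (fst c \<inter> Q))" if Q: "Q \<in> \<Q>" for Q
  proof -
    obtain d j where d: "smooth_chart A d" "Q \<subseteq> fst d" "snd d ` Q \<subseteq> {x :: real ^ 'n. x $ j = 0}"
      using bspec[OF \<Q>(2) Q] unfolding hypersurface_piece_def by (elim conjE exE) (rule that)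
    have chd: "is_chart d" and st: "smooth_transition d c"
      using d(1) c by (auto simp: smooth_chart_def)
    let ?Z = "snd d ` (fst c \<inter> Q)"
    have "negligible {x :: real ^ 'n. axis j 1 \<bullet> x = 0}"
      by (rule negligible_hyperplane) (simp add: axis_eq_0_iff)
    then have "negligible ?Z"
      by (rule negligible_subset) (use d(3) in \<open>auto simp: inner_axis'\<close>)
    moreover have "(snd c \<circ> chart_inv d) differentiable_on ?Z"
      using transition_differentiable[OF st] d(2)
      by (intro differentiable_at_imp_differentiable_on) auto
    ultimately have "negligible ((snd c \<circ> chart_inv d) ` ?Z)"
      by (intro negligible_differentiable_image_negligible) auto
    moreover have "(snd c \<circ> chart_inv d) ` ?Z = snd c ` (fst c \<inter> Q)"
      using d(2) chart_inv_image_eq[OF chd] by (auto simp: image_iff subset_iff)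
    ultimately show ?thesis by simp
  qed
  then have "negligible (\<Union>Q\<in>\<Q>. snd c ` (fst c \<inter> Q))"
    using \<Q>(1) by (intro negligible_Union) auto
  moreover have "(\<Union>Q\<in>\<Q>. snd c ` (fst c \<inter> Q)) = snd c ` (fst c \<inter> frontier R)"
    using \<Q>(3) by auto
  ultimately show ?thesis by simp
qed

section \<open>Integration of forms over the pieces\<close>

context
  fixes A :: "('m::t2_space, 'n::finite) chart set"
  assumes A: "oriented_smooth_atlas A" and comp: "compact (UNIV :: 'm set)"
begin

lemma chart_partition_memD:
  assumes "(c, B) \<in> chart_partition A"
  shows "c \<in> A" "is_chart c" "B \<in> sets borel" "closure B \<subseteq> fst c" "B \<subseteq> fst c"
proof -
  have "case (c, B) of (c, B) \<Rightarrow> c \<in> A \<and> B \<in> sets borel \<and> closure B \<subseteq> fst c"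
    using is_chart_partition_chart_partition[OF A comp] assms unfolding is_chart_partition_def by blast
  then show "c \<in> A" "B \<in> sets borel" "closure B \<subseteq> fst c" by simp_all
  then show "is_chart c" "B \<subseteq> fst c" using closure_subset[of B] atlasD(1)[OF A, of c] by blast+
qed

lemma chart_partition_open_image:
  assumes cB: "(c, B) \<in> chart_partition A" and U: "open U"
  shows "snd c ` (B \<inter> U) \<in> sets lebesgue"
proof -
  have "snd c ` (fst c \<inter> (B \<inter> U)) \<in> sets borel"
    using chart_partition_memD[OF cB] U by (intro chart_image_borel) auto
  moreover have "fst c \<inter> (B \<inter> U) = B \<inter> U" using chart_partition_memD(5)[OF cB] by blast
  ultimately show ?thesis by simp
qed

lemma set_integral_interior_piece:
  fixes g :: "real ^ 'n \<Rightarrow> 'b::{banach, second_countable_topology}"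
  assumes R: "piecewise_smooth_region A R" and D: "interior R \<subseteq> D"
    and cB: "(c, B) \<in> chart_partition A"
  shows "set_integrable lebesgue (snd c ` (B \<inter> (R \<inter> D))) g \<longleftrightarrow>
      set_integrable lebesgue (snd c ` (B \<inter> interior R)) g"
    and "set_integrable lebesgue (snd c ` (B \<inter> interior R)) g \<Longrightarrow>
      set_lebesgue_integral lebesgue (snd c ` (B \<inter> (R \<inter> D))) g =
      set_lebesgue_integral lebesgue (snd c ` (B \<inter> interior R)) g"
proof -
  note c = chart_partition_memD[OF cB]
  let ?E = "snd c ` (B \<inter> interior R)" and ?F = "snd c ` (B \<inter> (R \<inter> D))"
    and ?Z = "snd c ` (fst c \<inter> frontier R)"
  have Z: "negligible ?Z" by (rule frontier_negligible[OF A c(1) R])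
  have sub: "?E \<subseteq> ?F" using D interior_subset by blast
  have "R \<subseteq> interior R \<union> frontier R"
    using closure_subset[of R] by (auto simp: frontier_def)
  then have sup: "?F \<subseteq> ?E \<union> ?Z" using c(5) by blast
  have E: "?E \<in> sets lebesgue" by (rule chart_partition_open_image[OF cB open_interior])
  show "set_integrable lebesgue ?F g \<longleftrightarrow> set_integrable lebesgue ?E g"
  proof
    show "set_integrable lebesgue ?E g" if "set_integrable lebesgue ?F g"
      by (rule set_integrable_subset[OF that E sub])
    show "set_integrable lebesgue ?F g" if "set_integrable lebesgue ?E g"
      by (rule set_integrable_add_negligible(1)[OF that Z sub sup])
  qed
  show "set_integrable lebesgue ?E g \<Longrightarrow>
      set_lebesgue_integral lebesgue ?F g = set_lebesgue_integral lebesgue ?E g"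
    by (rule set_integrable_add_negligible(2)[OF _ Z sub sup])
qed

text \<open>Boundary points, regular or not, may be discarded, since the boundary is a null set.\<close>
lemma form_integrable_interior_iff:
  assumes "piecewise_smooth_region A R" "interior R \<subseteq> D"
  shows "form_integrable A (R \<inter> D) \<omega> \<longleftrightarrow> form_integrable A (interior R) \<omega>"
  using set_integral_interior_piece(1)[OF assms] unfolding form_integrable_def by fast

lemma form_integral_interior:
  assumes "piecewise_smooth_region A R" "interior R \<subseteq> D" and "form_integrable A (interior R) \<omega>"
  shows "form_integral A (R \<inter> D) \<omega> = form_integral A (interior R) \<omega>"
  unfolding form_integral_def
proof (rule sum.cong[OF refl], clarify)
  fix C f B assume cB: "((C, f), B) \<in> chart_partition A"
  then have "set_integrable lebesgue (snd (C, f) ` (B \<inter> interior R)) (\<lambda>x. \<omega> (C, f) (chart_inv (C, f) x))"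
    using assms(3) unfolding form_integrable_def by blast
  from set_integral_interior_piece(2)[OF assms(1,2) cB this]
  show "set_lebesgue_integral lebesgue (snd (C, f) ` (B \<inter> (R \<inter> D))) (\<lambda>x. \<omega> (C, f) (chart_inv (C, f) x)) =
      set_lebesgue_integral lebesgue (snd (C, f) ` (B \<inter> interior R)) (\<lambda>x. \<omega> (C, f) (chart_inv (C, f) x))" .
qed

lemma
  assumes "\<And>c p. c \<in> A \<Longrightarrow> p \<in> fst c \<Longrightarrow> p \<in> S \<Longrightarrow> \<omega> c p = \<omega>' c p"
  shows form_integrable_cong: "form_integrable A S \<omega> \<longleftrightarrow> form_integrable A S \<omega>'"
    and form_integral_cong: "form_integral A S \<omega> = form_integral A S \<omega>'"
proof -
  have eq: "(\<lambda>x. indicat_real (snd c ` (B \<inter> S)) x *\<^sub>R \<omega> c (chart_inv c x)) =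
      (\<lambda>x. indicat_real (snd c ` (B \<inter> S)) x *\<^sub>R \<omega>' c (chart_inv c x))"
    if cB: "(c, B) \<in> chart_partition A" for c B
  proof
    fix x
    show "indicat_real (snd c ` (B \<inter> S)) x *\<^sub>R \<omega> c (chart_inv c x) =
      indicat_real (snd c ` (B \<inter> S)) x *\<^sub>R \<omega>' c (chart_inv c x)"
    proof (cases "x \<in> snd c ` (B \<inter> S)")
      case True
      then obtain p where p: "p \<in> B" "p \<in> S" "x = snd c p" by blast
      note c = chart_partition_memD[OF cB]
      have "p \<in> fst c" using c(5) p(1) by blast
      then show ?thesis using assms[OF c(1)] p chart_inv_image_eq[OF c(2)] by simp
    qed simp
  qed
  show "form_integrable A S \<omega> \<longleftrightarrow> form_integrable A S \<omega>'"
    unfolding form_integrable_def set_integrable_def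
    by (intro ball_cong refl) (auto simp only: eq split: prod.splits)
  show "form_integral A S \<omega> = form_integral A S \<omega>'"
    unfolding form_integral_def set_lebesgue_integral_def
    by (intro sum.cong refl) (auto simp only: eq split: prod.splits)
qed

text \<open>In each chart the piece meets the closure of a block of the partition in a compact set, and there the
  density is bounded.\<close>
lemma form_integrable_energy:
  fixes Y N :: "'m \<Rightarrow> real ^ 'n option"
  assumes R: "closed R" and Y: "Cr_on A 1 R Y" and N: "Cr_on A 1 R N" "\<And>p. p \<in> R \<Longrightarrow> norm (N p) = 1"
    and \<gamma>: "continuous_on (sphere 0 1) \<gamma>"
  shows "form_integrable A (interior R) (\<lambda>c p. \<gamma> (N p) * vol_form N Y c p)"
  unfolding form_integrable_def
proof clarify
  fix C f B assume "((C, f), B) \<in> chart_partition A"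
  moreover define c where "c = (C, f)"
  ultimately have cB: "(c, B) \<in> chart_partition A" by simp
  note c = chart_partition_memD[OF cB]
  let ?S = "snd c ` (fst c \<inter> R)" and ?E = "snd c ` (B \<inter> interior R)" and ?K = "snd c ` (closure B \<inter> R)"
  let ?h = "\<lambda>x. \<gamma> ((N \<circ> chart_inv c) x) * frame_det ((N \<circ> chart_inv c) x)
      (\<lambda>j. frechet_derivative (Y \<circ> chart_inv c) (at x) (axis j 1))"
  have Yc: "Ck_on 1 ?S (Y \<circ> chart_inv c)"
    by (rule bspec[OF Y[unfolded Cr_on_def] c(1)])
  have Nc: "continuous_on ?S (N \<circ> chart_inv c)"
    by (rule Ck_on_imp_continuous_on[OF bspec[OF N(1)[unfolded Cr_on_def] c(1)]])
  have norm: "norm ((N \<circ> chart_inv c) x) = 1" if "x \<in> ?S" for x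
    using that N(2) chart_inv_image_eq[OF c(2)] by auto
  have "compact (closure B \<inter> R)"
    using compact_Int_closed[OF comp, of "closure B \<inter> R"] R by (simp add: closed_Int)
  moreover have "continuous_on (closure B \<inter> R) (snd c)"
  proof (rule continuous_on_subset[OF _ le_infI1[OF c(4)]])
    show "continuous_on (fst c) (snd c)" using c(2) by (simp add: is_chart_def homeomorphism_def)
  qed
  ultimately have K: "compact ?K" by (intro compact_continuous_image)
  have KS: "?K \<subseteq> ?S" using c(4) by blast
  have EK: "?E \<subseteq> ?K" using closure_subset interior_subset by blast
  have ES: "?E \<subseteq> interior ?S" using chart_image_interior[OF c(2), of R] c(5) by blast
  obtain M where M: "\<And>x. x \<in> ?K \<inter> interior ?S \<Longrightarrow> \<bar>?h x\<bar> \<le> M"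
    using energy_density_bounded[OF Yc Nc norm \<gamma> K KS] by blast
  have "set_integrable lebesgue ?E ?h"
  proof (rule set_integrable_continuous_bounded)
    show "?E \<in> sets lebesgue" by (rule chart_partition_open_image[OF cB open_interior])
    show "bounded ?E" using K EK bounded_subset compact_imp_bounded by blast
    show "continuous_on ?E ?h"
      by (rule continuous_on_subset[OF energy_density_continuous[OF Yc Nc norm \<gamma>] ES])
    show "\<bar>?h x\<bar> \<le> M" if "x \<in> ?E" for x using M that EK ES by blast
  qed
  moreover have "indicat_real ?E x *\<^sub>R ?h x =
      indicat_real ?E x *\<^sub>R (\<gamma> (N (chart_inv c x)) * vol_form N Y c (chart_inv c x))" for x
  proof (cases "x \<in> ?E")
    case True
    then have "snd c (chart_inv c x) = x" using c(5) chart_inv_image_eq[OF c(2)] by auto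
    then show ?thesis by (simp add: vol_form_def chart_partial_def chart_deriv_def)
  qed simp
  ultimately show "set_integrable lebesgue (snd (C, f) ` (B \<inter> interior R))
      (\<lambda>x. \<gamma> (N (chart_inv (C, f) x)) * vol_form N Y (C, f) (chart_inv (C, f) x))"
    unfolding set_integrable_def c_def[symmetric] by (simp only:)
qed

text \<open>On a piece \<open>\<gamma> \<circ> N\<close> is continuous and bounded, so integrability of the mean curvature against the volume
  form carries over to the weighted integrals.\<close>
lemma form_integrable_bounded_mult:
  fixes N :: "'m \<Rightarrow> real ^ 'n option" and \<omega> :: "('m, 'n) chart \<Rightarrow> 'm \<Rightarrow> complex"
  assumes N: "Cr_on A 1 R N" "\<And>p. p \<in> R \<Longrightarrow> norm (N p) = 1"
    and \<gamma>: "continuous_on (sphere 0 1) \<gamma>" and \<omega>: "form_integrable A (interior R) \<omega>"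
  shows "form_integrable A (interior R) (\<lambda>c p. complex_of_real (\<gamma> (N p)) * \<omega> c p)"
  unfolding form_integrable_def
proof clarify
  fix C f B assume "((C, f), B) \<in> chart_partition A"
  moreover define c where "c = (C, f)"
  ultimately have cB: "(c, B) \<in> chart_partition A" by simp
  note c = chart_partition_memD[OF cB]
  let ?S = "snd c ` (fst c \<inter> R)" and ?E = "snd c ` (B \<inter> interior R)"
  have "compact (\<gamma> ` sphere 0 1)"
    using \<gamma> compact_sphere by (rule compact_continuous_image)
  then obtain G where G: "\<And>v. norm v = 1 \<Longrightarrow> \<bar>\<gamma> v\<bar> \<le> G"
    using compact_imp_bounded[THEN bounded_iff[THEN iffD1]] by (metis image_eqI mem_sphere_0 real_norm_def)
  have Nc: "continuous_on ?S (N \<circ> chart_inv c)"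
    by (rule Ck_on_imp_continuous_on[OF bspec[OF N(1)[unfolded Cr_on_def] c(1)]])
  have norm: "norm ((N \<circ> chart_inv c) x) = 1" if "x \<in> ?S" for x
    using that N(2) chart_inv_image_eq[OF c(2)] by auto
  have ES: "?E \<subseteq> ?S" using c(5) interior_subset by blast
  have "set_integrable lebesgue ?E (\<lambda>x. complex_of_real (\<gamma> ((N \<circ> chart_inv c) x)) * \<omega> c (chart_inv c x))"
  proof (rule set_integrable_continuous_bounded_mult)
    show "?E \<in> sets lebesgue" by (rule chart_partition_open_image[OF cB open_interior])
    show "continuous_on ?E (\<lambda>x. \<gamma> ((N \<circ> chart_inv c) x))"
      by (rule continuous_on_compose2[OF \<gamma> continuous_on_subset[OF Nc ES]]) (use norm ES in force)
    show "\<bar>\<gamma> ((N \<circ> chart_inv c) x)\<bar> \<le> G" if "x \<in> ?E" for x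
      using that ES norm by (intro G) blast
    show "set_integrable lebesgue ?E (\<lambda>x. \<omega> c (chart_inv c x))"
      using \<omega> cB unfolding form_integrable_def by blast
  qed
  then show "set_integrable lebesgue (snd (C, f) ` (B \<inter> interior R))
      (\<lambda>x. complex_of_real (\<gamma> (N (chart_inv (C, f) x))) * \<omega> (C, f) (chart_inv (C, f) x))"
    unfolding c_def[symmetric] by simp
qed

end

lemma form_integral_complex_of_real:
  "form_integral A S (\<lambda>c p. complex_of_real (\<omega> c p)) = complex_of_real (form_integral A S \<omega>)"
  unfolding form_integral_def by (simp add: set_integral_complex_of_real case_prod_beta')

lemma form_integral_lincomb:
  fixes \<omega> :: "'i \<Rightarrow> ('m::topological_space, 'n::finite) chart \<Rightarrow> 'm \<Rightarrow> complex"
  assumes "\<And>r. r \<in> I \<Longrightarrow> form_integrable A S (\<omega> r)"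
  shows "form_integral A S (\<lambda>c p. \<Sum>r\<in>I. a r * \<omega> r c p) = (\<Sum>r\<in>I. a r * form_integral A S (\<omega> r))"
proof -
  have "form_integral A S (\<lambda>c p. \<Sum>r\<in>I. a r * \<omega> r c p) =
      (\<Sum>(c, B)\<in>chart_partition A. \<Sum>r\<in>I. a r *
        set_lebesgue_integral lebesgue (snd c ` (B \<inter> S)) (\<lambda>x. \<omega> r c (chart_inv c x)))"
    unfolding form_integral_def
  proof (intro sum.cong refl, clarify)
    fix C f B assume "((C, f), B) \<in> chart_partition A"
    moreover define c where "c = (C, f)"
    ultimately have cB: "(c, B) \<in> chart_partition A" by simp
    have int: "integrable lebesgue (\<lambda>x. indicat_real (snd c ` (B \<inter> S)) x *\<^sub>R \<omega> r c (chart_inv c x))"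
      if "r \<in> I" for r
      using assms[OF that] cB unfolding form_integrable_def set_integrable_def by blast
    have "set_lebesgue_integral lebesgue (snd c ` (B \<inter> S)) (\<lambda>x. \<Sum>r\<in>I. a r * \<omega> r c (chart_inv c x)) =
        (LINT x|lebesgue. (\<Sum>r\<in>I. a r * (indicat_real (snd c ` (B \<inter> S)) x *\<^sub>R \<omega> r c (chart_inv c x))))"
      unfolding set_lebesgue_integral_def
      by (intro Bochner_Integration.integral_cong refl) (simp add: scaleR_sum_right)
    also have "\<dots> = (\<Sum>r\<in>I. a r * set_lebesgue_integral lebesgue (snd c ` (B \<inter> S)) (\<lambda>x. \<omega> r c (chart_inv c x)))"
      unfolding set_lebesgue_integral_def
      by (subst Bochner_Integration.integral_sum)
        (intro integrable_mult_right int, assumption, simp only: integral_mult_right_zero)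
    finally show "set_lebesgue_integral lebesgue (snd (C, f) ` (B \<inter> S))
          (\<lambda>x. \<Sum>r\<in>I. a r * \<omega> r (C, f) (chart_inv (C, f) x)) =
        (\<Sum>r\<in>I. a r * set_lebesgue_integral lebesgue (snd (C, f) ` (B \<inter> S))
          (\<lambda>x. \<omega> r (C, f) (chart_inv (C, f) x)))"
      unfolding c_def .
  qed
  also have "\<dots> = (\<Sum>r\<in>I. a r * form_integral A S (\<omega> r))"
    unfolding form_integral_def sum_distrib_left case_prod_beta' by (rule sum.swap)
  finally show ?thesis .
qed

lemma form_integrable_complex_of_real:
  "form_integrable A S \<omega> \<Longrightarrow> form_integrable A S (\<lambda>c p. complex_of_real (\<omega> c p))"
  unfolding form_integrable_def
proof (rule ballI)
  fix cB assume int: "\<forall>(c, B)\<in>chart_partition A. set_integrable lebesgue (snd c ` (B \<inter> S)) (\<lambda>x. \<omega> c (chart_inv c x))"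
    and cB: "cB \<in> chart_partition A"
  obtain c B where cB': "cB = (c, B)" by fastforce
  have "set_integrable lebesgue (snd c ` (B \<inter> S)) (\<lambda>x. \<omega> c (chart_inv c x))"
    using int cB unfolding cB' by blast
  then have "integrable lebesgue (\<lambda>x. complex_of_real (indicat_real (snd c ` (B \<inter> S)) x *\<^sub>R \<omega> c (chart_inv c x)))"
    unfolding set_integrable_def by (rule integrable_of_real)
  moreover have "(\<lambda>x. complex_of_real (indicat_real (snd c ` (B \<inter> S)) x *\<^sub>R \<omega> c (chart_inv c x))) =
      (\<lambda>x. indicat_real (snd c ` (B \<inter> S)) x *\<^sub>R complex_of_real (\<omega> c (chart_inv c x)))"
    by (auto simp: indicator_def)
  ultimately show "case cB of (c, B) \<Rightarrow>
      set_integrable lebesgue (snd c ` (B \<inter> S)) (\<lambda>x. complex_of_real (\<omega> c (chart_inv c x)))"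
    unfolding cB' set_integrable_def by simp
qed

lemma vol_form_cong:
  assumes "is_chart c" "p \<in> fst c" "open U" "p \<in> U" "\<And>q. q \<in> U \<Longrightarrow> f q = g q" "\<nu> p = \<mu> p"
  shows "vol_form \<nu> f c p = vol_form \<mu> g c p"
  using chart_deriv_cong[OF assms(1,3,4,2,5)] assms(6)
  by (simp add: vol_form_def chart_partial_def)

lemma sum_mean_curvature:
  fixes A :: "('m::topological_space, 'n::finite) chart set"
  shows "(\<Prod>l=1..CARD('n). 1 - s * aniso_curvature A \<gamma> X l p) =
    (\<Sum>r=0..CARD('n). (- 1) ^ r * s ^ r * of_nat (CARD('n) choose r) * aniso_mean_curvature A \<gamma> X r p)"
  unfolding prod_one_minus_eq_sum
proof (rule sum.cong[OF refl])
  fix r assume "r \<in> {0..CARD('n)}"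
  then have "of_nat (CARD('n) choose r) \<noteq> (0 :: complex)"
    by (simp add: binomial_eq_0_iff not_less)
  then show "(- 1) ^ r * s ^ r * (\<Sum>L | L \<subseteq> {1..CARD('n)} \<and> card L = r. \<Prod>l\<in>L. aniso_curvature A \<gamma> X l p) =
      (- 1) ^ r * s ^ r * of_nat (CARD('n) choose r) * aniso_mean_curvature A \<gamma> X r p"
    by (simp add: aniso_mean_curvature_def)
qed

lemma aniso_mean_curvature_0: "aniso_mean_curvature A \<gamma> X 0 p = 1"
proof -
  have "{L. L \<subseteq> {1..CARD('b)} \<and> card L = 0} = {{}}"
    by (auto dest: finite_subset)
  then show ?thesis by (simp add: aniso_mean_curvature_def)
qed

section \<open>The energy of the parallel hypersurfaces\<close>
theorem theorem10p1:
  fixes A :: "('m::{t2_space, second_countable_topology}, 'n::finite) chart set"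
    and k :: nat and P :: "nat \<Rightarrow> 'm set"
    and X :: "'m \<Rightarrow> real ^ 'n option"
    and \<gamma> :: "real ^ 'n option \<Rightarrow> real" and t :: real
  assumes "compact (UNIV :: 'm set)" and "connected (UNIV :: 'm set)"
    and "oriented_smooth_atlas A"
    and "piecewise_decomposition A k P"
    and "\<forall>v\<in>sphere 0 1. \<gamma> v > 0" and "Ck_on 2 (sphere 0 1) \<gamma>"
    and "piecewise_weak_immersion A k P 2 X"
  shows "let D = UNIV - singular_points A 2 X;
             \<nu> = unit_normal A X;
             X\<^sub>t = aniso_parallel A \<gamma> X t;
             \<kappa> = aniso_curvature A \<gamma> X;
             H = aniso_mean_curvature A \<gamma> X;
             dA = vol_form \<nu> X;
             dA\<^sub>t = vol_form \<nu> X\<^sub>t;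
             F\<^sub>t = aniso_energy A k P D \<gamma> \<nu> X\<^sub>t
         in (pieces_integrable A k P D (\<lambda>c p. \<gamma> (\<nu> p) * dA\<^sub>t c p) \<and>
             F\<^sub>t = pieces_integral A k P D (\<lambda>c p. \<gamma> (\<nu> p) * dA\<^sub>t c p) \<and>
             complex_of_real F\<^sub>t = pieces_integral A k P D
               (\<lambda>c p. complex_of_real (\<gamma> (\<nu> p)) * (\<Prod>l=1..CARD('n). 1 - complex_of_real t * \<kappa> l p)
                      * complex_of_real (dA c p))) \<and>
            ((\<forall>r\<in>{1..CARD('n)}. pieces_integrable A k P D (\<lambda>c p. H r p * complex_of_real (dA c p))) \<longrightarrow>
             complex_of_real F\<^sub>t = (\<Sum>r=0..CARD('n). (-1) ^ r * complex_of_real t ^ r *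
               of_nat (CARD('n) choose r) *
               pieces_integral A k P D
                 (\<lambda>c p. complex_of_real (\<gamma> (\<nu> p)) * H r p * complex_of_real (dA c p))))"
proof -
  note comp = assms(1) and A = assms(3) and \<gamma>2 = assms(6)
  let ?I = "{1..k}" and ?Q = "\<lambda>i. interior (P i)"
  let ?D = "UNIV - singular_points A 2 X" and ?\<nu> = "unit_normal A X"
  let ?E = "\<lambda>s c p. \<gamma> (?\<nu> p) * vol_form ?\<nu> (aniso_parallel A \<gamma> X s) c p"
  let ?H = "\<lambda>r c p. aniso_mean_curvature A \<gamma> X r p * complex_of_real (vol_form ?\<nu> X c p)"
  let ?\<gamma>H = "\<lambda>r c p. complex_of_real (\<gamma> (?\<nu> p)) * aniso_mean_curvature A \<gamma> X r p *
    complex_of_real (vol_form ?\<nu> X c p)"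
  let ?\<gamma>K = "\<lambda>c p. complex_of_real (\<gamma> (?\<nu> p)) *
    (\<Prod>l=1..CARD('n). 1 - complex_of_real t * aniso_curvature A \<gamma> X l p) *
    complex_of_real (vol_form ?\<nu> X c p)"
  have \<gamma>c: "continuous_on (sphere 0 1) \<gamma>"
    using \<gamma>2 by (rule Ck_on_imp_continuous_on)
  have region: "piecewise_smooth_region A (P i)" if "i \<in> ?I" for i
    using assms(4) that unfolding piecewise_decomposition_def by blast
  then have closed: "closed (P i)" if "i \<in> ?I" for i
    using that compact_imp_closed unfolding piecewise_smooth_region_def by blast
  have imm: "Cr_on A 2 (P i) X \<and> (\<forall>p\<in>?Q i. immersion_at A 2 X p) \<and>
      (\<exists>N. Cr_on A (2 - 1) (P i) N \<and> (\<forall>p\<in>P i. norm (N p) = 1) \<and> (\<forall>p\<in>?Q i. is_unit_normal A X p (N p)))"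
    if "i \<in> ?I" for i
    using assms(7) that unfolding piecewise_weak_immersion_def by blast
  have X1: "Cr_on A 1 (P i) X" if "i \<in> ?I" for i
    using imm[OF that] Cr_on_SucD[of A 1 "P i" X] by (simp add: numeral_2_eq_2)
  have regular: "?Q i \<subseteq> ?D" if "i \<in> ?I" for i
    using imm[OF that] unfolding singular_points_def by blast
  have "\<forall>i\<in>?I. \<exists>N. Cr_on A 1 (P i) N \<and> (\<forall>p\<in>P i. norm (N p) = 1) \<and>
      (\<forall>p\<in>?Q i. is_unit_normal A X p (N p))"
    using imm by simp
  then obtain N where N: "\<And>i. i \<in> ?I \<Longrightarrow> Cr_on A 1 (P i) (N i)"
    "\<And>i p. i \<in> ?I \<Longrightarrow> p \<in> P i \<Longrightarrow> norm (N i p) = 1"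
    "\<And>i p. i \<in> ?I \<Longrightarrow> p \<in> ?Q i \<Longrightarrow> is_unit_normal A X p (N i p)"
    by metis
  have \<nu>: "?\<nu> p = N i p" if "i \<in> ?I" "p \<in> ?Q i" for i p
    by (rule unit_normal_eqI[OF A N(3)[OF that]])
  have point: "aniso_regular_point A \<gamma> X p" if "i \<in> ?I" "p \<in> ?Q i" for i p
    by (rule aniso_regular_pointI[OF A \<gamma>2 X1 N(1) N(2) N(3)]) (use that in auto)

  \<comment> \<open>Up to the boundary of the piece, \<open>N i\<close> takes the place of the unit normal, which is defined
      only at regular points.\<close>
  have int_E: "form_integrable A (?Q i) (?E s)" if i: "i \<in> ?I" for i s
  proof -
    let ?\<xi> = "\<lambda>p. s *\<^sub>R cahn_hoffman \<gamma> (N i p)"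
    let ?Y = "\<lambda>p. X p + ?\<xi> p"
    have "Ck_on 1 (sphere 0 1) (\<lambda>v. s *\<^sub>R cahn_hoffman \<gamma> v)"
      by (rule C1_on_linear[OF bounded_linear_scaleR_right cahn_hoffman_C1[OF \<gamma>2]])
    then have "Cr_on A 1 (P i) ?\<xi>"
      using N(2)[OF i] by (intro Cr_on_compose_C1[OF N(1)[OF i] _ _ A]) auto
    then have Y: "Cr_on A 1 (P i) ?Y" by (rule Cr_on_add_C1[OF X1[OF i]])
    have "form_integrable A (?Q i) (\<lambda>c p. \<gamma> (N i p) * vol_form (N i) ?Y c p)"
      by (rule form_integrable_energy[OF A comp closed[OF i] Y N(1)[OF i] N(2)[OF i] \<gamma>c])
    moreover have "?E s c p = \<gamma> (N i p) * vol_form (N i) ?Y c p"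
      if "c \<in> A" "p \<in> fst c" "p \<in> ?Q i" for c p
    proof -
      have "vol_form ?\<nu> (aniso_parallel A \<gamma> X s) c p = vol_form (N i) ?Y c p"
        by (rule vol_form_cong[OF atlasD(1)[OF A that(1)] that(2) open_interior[of "P i"] that(3)])
          (use \<nu>[OF i] that(3) in \<open>auto simp: aniso_parallel_def cahn_hoffman_field_def\<close>)
      then show ?thesis using \<nu>[OF i that(3)] by simp
    qed
    ultimately show ?thesis
      by (subst form_integrable_cong[OF A comp]) (assumption | simp only:)+
  qed

  have interior: "pieces_integral A k P ?D \<omega> = (\<Sum>i=1..k. form_integral A (?Q i) \<omega>)"
    if "\<And>i. i \<in> ?I \<Longrightarrow> form_integrable A (?Q i) \<omega>" for \<omega> :: "('m, 'n) chart \<Rightarrow> 'm \<Rightarrow> 'z::{banach, second_countable_topology}"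
    unfolding pieces_integral_def
    by (intro sum.cong refl form_integral_interior[OF A comp region regular that])

  have E_eq: "aniso_energy A k P ?D \<gamma> ?\<nu> (aniso_parallel A \<gamma> X t) = (\<Sum>i=1..k. form_integral A (?Q i) (?E t))"
    unfolding aniso_energy_def by (rule interior[OF int_E])

  have int_EC: "form_integrable A (?Q i) (\<lambda>c p. complex_of_real (?E s c p))" if "i \<in> ?I" for i s
    by (rule form_integrable_complex_of_real[OF int_E[OF that]])

  have E_eqC: "complex_of_real (aniso_energy A k P ?D \<gamma> ?\<nu> (aniso_parallel A \<gamma> X t)) =
      (\<Sum>i=1..k. form_integral A (?Q i) (\<lambda>c p. complex_of_real (?E t c p)))"
    unfolding E_eq by (simp only: form_integral_complex_of_real of_real_sum)

  have pointK: "?\<gamma>K c p = complex_of_real (?E t c p)"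
    if "i \<in> ?I" "c \<in> A" "p \<in> fst c" "p \<in> ?Q i" for i c p
    using aniso_regular_point.vol_form_parallel_curvatures[OF point[OF that(1,4)] that(2,3), of t ?\<nu>]
    by (simp add: mult.assoc)

  show ?thesis
  proof (unfold Let_def, intro conjI impI)
    show "pieces_integrable A k P ?D (?E t)"
      unfolding pieces_integrable_def
      using form_integrable_interior_iff[OF A comp region regular] int_E by blast
    show "aniso_energy A k P ?D \<gamma> ?\<nu> (aniso_parallel A \<gamma> X t) = pieces_integral A k P ?D (?E t)"
      unfolding aniso_energy_def ..
    have "form_integrable A (?Q i) ?\<gamma>K" if i: "i \<in> ?I" for i
      by (subst form_integrable_cong[OF A comp pointK[OF i]]) (assumption | rule int_EC[OF i])+
    then have "pieces_integral A k P ?D ?\<gamma>K = (\<Sum>i=1..k. form_integral A (?Q i) ?\<gamma>K)"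
      by (rule interior)
    also have "\<dots> = (\<Sum>i=1..k. form_integral A (?Q i) (\<lambda>c p. complex_of_real (?E t c p)))"
      by (intro sum.cong refl form_integral_cong[OF A comp] pointK)
    finally show "complex_of_real (aniso_energy A k P ?D \<gamma> ?\<nu> (aniso_parallel A \<gamma> X t)) =
        pieces_integral A k P ?D ?\<gamma>K"
      unfolding E_eqC ..
  next
    assume H: "\<forall>r\<in>{1..CARD('n)}. pieces_integrable A k P ?D (?H r)"
    let ?a = "\<lambda>r. (-1) ^ r * complex_of_real t ^ r * of_nat (CARD('n) choose r)"
    have int_H: "form_integrable A (?Q i) (?\<gamma>H r)" if i: "i \<in> ?I" and r: "r \<in> {0..CARD('n)}" for i r
    proof (cases "r = 0")
      case True
      \<comment> \<open>\<open>H\<^sub>0 = 1\<close> is not among the integrability hypotheses: this term is the energy of \<open>X\<close> itself,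
          the parallel hypersurface of height zero.\<close>
      have "aniso_parallel A \<gamma> X 0 = X" by (auto simp: aniso_parallel_def)
      then show ?thesis using int_EC[OF i, of 0] True by (simp add: aniso_mean_curvature_0)
    next
      case False
      then have "pieces_integrable A k P ?D (?H r)" using H r by simp
      then have Hr: "form_integrable A (?Q i) (?H r)"
        using form_integrable_interior_iff[OF A comp region[OF i] regular[OF i]] i
        unfolding pieces_integrable_def by blast
      have "form_integrable A (?Q i) (\<lambda>c p. complex_of_real (\<gamma> (N i p)) * ?H r c p)"
        by (rule form_integrable_bounded_mult[OF A comp N(1)[OF i] N(2)[OF i] \<gamma>c Hr])
      then show ?thesis
        by (subst form_integrable_cong[OF A comp]) (auto simp: \<nu>[OF i] mult.assoc)
    qed
    have "form_integral A (?Q i) (\<lambda>c p. complex_of_real (?E t c p)) =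
        (\<Sum>r=0..CARD('n). ?a r * form_integral A (?Q i) (?\<gamma>H r))" if i: "i \<in> ?I" for i
    proof -
      have "complex_of_real (?E t c p) = (\<Sum>r=0..CARD('n). ?a r * ?\<gamma>H r c p)"
        if "c \<in> A" "p \<in> fst c" "p \<in> ?Q i" for c p
        unfolding pointK[OF i that, symmetric] sum_mean_curvature
        by (simp add: sum_distrib_left sum_distrib_right mult_ac)
      then have "form_integral A (?Q i) (\<lambda>c p. complex_of_real (?E t c p)) =
          form_integral A (?Q i) (\<lambda>c p. \<Sum>r=0..CARD('n). ?a r * ?\<gamma>H r c p)"
        by (rule form_integral_cong[OF A comp])
      also have "\<dots> = (\<Sum>r=0..CARD('n). ?a r * form_integral A (?Q i) (?\<gamma>H r))"
        by (rule form_integral_lincomb[OF int_H[OF i]])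
      finally show ?thesis .
    qed
    then have "complex_of_real (aniso_energy A k P ?D \<gamma> ?\<nu> (aniso_parallel A \<gamma> X t)) =
        (\<Sum>i=1..k. \<Sum>r=0..CARD('n). ?a r * form_integral A (?Q i) (?\<gamma>H r))"
      unfolding E_eqC by (intro sum.cong refl)
    also have "\<dots> = (\<Sum>r=0..CARD('n). ?a r * (\<Sum>i=1..k. form_integral A (?Q i) (?\<gamma>H r)))"
      unfolding sum_distrib_left by (rule sum.swap)
    also have "\<dots> = (\<Sum>r=0..CARD('n). ?a r * pieces_integral A k P ?D (?\<gamma>H r))"
      by (intro sum.cong refl arg_cong[where f = "\<lambda>z. _ * z"] interior[symmetric] int_H)
    finally show "complex_of_real (aniso_energy A k P ?D \<gamma> ?\<nu> (aniso_parallel A \<gamma> X t)) =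
        (\<Sum>r=0..CARD('n). ?a r * pieces_integral A k P ?D (?\<gamma>H r))" .
  qed
qed

end
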